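(* In the setting described in the context, let $T_\sigma$ be a pseudo-differential operator with symbol $\sigma(x,\xi)$ such that $\sigma(\cdot,\xi)\in L^2(\Omega)$ for each $\xi\in\mathcal I$. Suppose that $\sigma$ satisfies: (i) $\displaystyle\inf_{\xi\in\mathcal I}\Big|\int_\Omega\sigma(x,\xi)u_\xi(x)\overline{v_\xi(x)}\,dx\Big|>0$; (ii) $\displaystyle\sup_{\xi\in\mathcal I}\Big(\Big|\int_\Omega\sigma(x,\xi)u_\xi(x)\overline{v_\xi(x)}\,dx\Big|^{-1}\sum_{\zeta\ne\xi}|(T_\sigma u_\zeta,v_\xi)_{L^2(\Omega)}|\Big)<1$; (iii) $\displaystyle\sup_{\xi\in\mathcal I}\Big(\Big|\int_\Omega\sigma(x,\xi)u_\xi(x)\overline{v_\xi(x)}\,dx\Big|^{-1}\sum_{\zeta\ne\xi}|(T_\sigma u_\xi,v_\zeta)_{L^2(\Omega)}|\Big)<1$. Then $T_\sigma$ is an invertible linear operator with bounded inverse. In particular, if $$\lim_{|\xi|\to\infty}\Big|\int_\Omega\sigma(x,\xi)u_\xi(x)\overline{v_\xi(x)}\,dx\Big|=\infty,$$ then the inverse is a compact operator.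
   Context: Setting. $\Omega$ is a smooth $d$-dimensional manifold with boundary $\partial\Omega$ such that $\overline\Omega$ is a compact manifold (not necessarily smooth at the boundary), with a measure $dx$ which, if finite, is normalised to total mass $1$; $(f,g)_{L^2(\Omega)}=\int_\Omega f\overline g\,dx$. $\mathfrak L$ is a differential operator of order $m_{\mathfrak L}$ with smooth bounded coefficients in $\Omega$, equipped with fixed linear boundary conditions (BC) leading to a discrete spectrum $\{\lambda_\xi:\xi\in\mathcal I\}$, where $\mathcal I\subseteq\mathbb Z^l$ is a countable index set ($|\xi|$ is the norm of $\xi$ in $\mathbb Z^l$), with eigenfunctions $u_\xi$ satisfying (BC), $\mathfrak L u_\xi=\lambda_\xi u_\xi$, forming a Riesz basis of $L^2(\Omega)$ (dense span and $c\sum|a_\xi|^2\le\|\sum a_\xi u_\xi\|^2_{L^2}\le C\sum|a_\xi|^2$ with $0<c\le C<\infty$). $v_\xi$ are the eigenfunctions of the conjugate problem $\mathfrak L^*v_\xi=\overline{\lambda_\xi}v_\xi$ with conjugate boundary conditions (BC)$^*$. One has $\|u_\xi\|_{L^2}=\|v_\xi\|_{L^2}=1$ and $(u_\xi,v_\eta)_{L^2}=\delta_{\xi\eta}$. Put $\langle\xi\rangle:=(1+|\lambda_\xi|^2)^{1/(2m_{\mathfrak L})}$; it is assumed that $\sup_{x\in\Omega}|u_\xi(x)|\le C_b\langle\xi\rangle^{\mu_0}$ for some $C_b,\mu_0>0$ and all $\xi$. For a measurable $\sigma:\overline\Omega\times\mathcal I\to\mathbb C$ with $\sigma(\cdot,\xi)\in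 L^2(\Omega)$ for all $\xi$, the associated $\mathfrak L$-pseudo-differential operator, acting initially on $\mathrm{Span}\{u_\xi\}$, is $T_\sigma f(x)=\sum_{\xi\in\mathcal I}\sigma(x,\xi)\widehat f(\xi)u_\xi(x)$, where $\widehat f(\xi)=\mathcal F_{\mathfrak L}f(\xi)=\int_\Omega f\,\overline{v_\xi}\,dx$. Its associated matrix $M_\sigma:\mathcal I\times\mathcal I\to\mathbb C$ has entries $(M_\sigma)_{\gamma\xi}:=(T_\sigma u_\xi,v_\gamma)_{L^2(\Omega)}$ (so the diagonal entries are $\int_\Omega\sigma(x,\xi)u_\xi\overline{v_\xi}\,dx$), acting on sequences by $M\varphi(\xi)=\sum_\eta M_{\xi\eta}\varphi(\eta)$. Considered as an operator in $L^2(\Omega)$, $T_\sigma$ is identified with $M_\sigma$ acting in $\ell^2(\mathcal I)$ via $T_\sigma=\mathcal F_{\mathfrak L}^{-1}M_\sigma\mathcal F_{\mathfrak L}$ ($\mathcal F_{\mathfrak L}:L^2(\Omega)\to\ell^2(\mathcal I)$ is a topological isomorphism). *)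

theory Defs
  imports "HOL-Analysis.Analysis"
begin

section \<open>Smooth manifolds and differential operators in charts\<close>

definition partial_deriv :: "'d::finite \<Rightarrow> (real^'d \<Rightarrow> 'b::real_normed_vector) \<Rightarrow> real^'d \<Rightarrow> 'b" where
  "partial_deriv i f x = frechet_derivative f (at x) (axis i 1)"

primrec Ck_on :: "nat \<Rightarrow> (real^'d::finite) set \<Rightarrow> (real^'d \<Rightarrow> 'b::real_normed_vector) \<Rightarrow> bool" where
  "Ck_on 0 S f \<longleftrightarrow> continuous_on S f"
| "Ck_on (Suc k) S f \<longleftrightarrow> f differentiable_on S \<and> (\<forall>i. Ck_on k S (partial_deriv i f))"

definition smooth_on :: "(real^'d::finite) set \<Rightarrow> (real^'d \<Rightarrow> 'b::real_normed_vector) \<Rightarrow> bool" where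
  "smooth_on S f \<longleftrightarrow> (\<forall>k. Ck_on k S f)"

text \<open>The choice of the order of differentiation is immaterial on functions of class C^|alpha|.\<close>

definition multi_deriv :: "('d::finite \<Rightarrow> nat) \<Rightarrow> (real^'d \<Rightarrow> complex) \<Rightarrow> real^'d \<Rightarrow> complex" where
  "multi_deriv \<alpha> f = foldr partial_deriv (SOME is. \<forall>i. count_list is i = \<alpha> i) f"

text \<open>The closure of \<open>\<Omega>\<close> is a compact topological manifold with interior \<open>\<Omega>\<close> and boundary
  \<open>closure \<Omega> - \<Omega>\<close>; no smoothness is required at the boundary.  The itself argument fixes the
  dimension \<open>CARD('d)\<close>.\<close>

definition compact_manifold_closure :: "'d::finite itself \<Rightarrow> 'a::t2_space set \<Rightarrow> bool" where
  "compact_manifold_closure d \<Omega> \<longleftrightarrow> compact (closure \<Omega>) \<and>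
     (\<forall>p\<in>closure \<Omega>. \<exists>U V (\<phi>::'a \<Rightarrow> real^'d) \<psi> k.
        p \<in> U \<and> openin (top_of_set (closure \<Omega>)) U \<and>
        openin (top_of_set {y. 0 \<le> y $ k}) V \<and> homeomorphism U V \<phi> \<psi> \<and>
        \<phi> ` (U \<inter> \<Omega>) = V \<inter> {y. 0 < y $ k})"

type_synonym ('a, 'd) chart = "'a set \<times> ('a \<Rightarrow> real^'d)"

definition smooth_atlas :: "'a::t2_space set \<Rightarrow> ('a, 'd::finite) chart set \<Rightarrow> bool" where
  "smooth_atlas \<Omega> A \<longleftrightarrow> (\<Union>(U, \<phi>)\<in>A. U) = \<Omega> \<and>
     (\<forall>(U, \<phi>)\<in>A. openin (top_of_set \<Omega>) U \<and> open (\<phi> ` U) \<and>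
        homeomorphism U (\<phi> ` U) \<phi> (inv_into U \<phi>)) \<and>
     (\<forall>(U, \<phi>)\<in>A. \<forall>(W, \<theta>)\<in>A. smooth_on (\<phi> ` (U \<inter> W)) (\<theta> \<circ> inv_into U \<phi>))"

definition Ck_manifold :: "('a, 'd::finite) chart set \<Rightarrow> nat \<Rightarrow> ('a \<Rightarrow> complex) \<Rightarrow> bool" where
  "Ck_manifold A k f \<longleftrightarrow> (\<forall>(U, \<phi>)\<in>A. Ck_on k (\<phi> ` U) (f \<circ> inv_into U \<phi>))"

text \<open>A differential operator of order (exactly) \<open>m\<close> whose coefficients in the charts of \<open>A\<close> are
  smooth and bounded, uniformly over \<open>A\<close>.  It is applied to functions of class C^m only.\<close>

definition diff_op ::
  "('a, 'd::finite) chart set \<Rightarrow> nat \<Rightarrow> (('a \<Rightarrow> complex) \<Rightarrow> 'a \<Rightarrow> complex) \<Rightarrow> bool" where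
  "diff_op A m L \<longleftrightarrow> (\<exists>(a :: ('a, 'd) chart \<Rightarrow> ('d \<Rightarrow> nat) \<Rightarrow> real^'d \<Rightarrow> complex) K.
     (\<forall>(U, \<phi>)\<in>A. \<forall>\<alpha>. sum \<alpha> UNIV \<le> m \<longrightarrow>
        smooth_on (\<phi> ` U) (a (U, \<phi>) \<alpha>) \<and> (\<forall>y\<in>\<phi> ` U. cmod (a (U, \<phi>) \<alpha> y) \<le> K)) \<and>
     (\<exists>(U, \<phi>)\<in>A. \<exists>\<alpha>. sum \<alpha> UNIV = m \<and> (\<exists>y\<in>\<phi> ` U. a (U, \<phi>) \<alpha> y \<noteq> 0)) \<and>
     (\<forall>f. Ck_manifold A m f \<longrightarrow> (\<forall>(U, \<phi>)\<in>A. \<forall>x\<in>U.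
        L f x = (\<Sum>\<alpha> | sum \<alpha> UNIV \<le> m.
          a (U, \<phi>) \<alpha> (\<phi> x) * multi_deriv \<alpha> (f \<circ> inv_into U \<phi>) (\<phi> x)))))"


section \<open>Square integrable functions and operators on them\<close>

text \<open>Elements of \<open>L2 M\<close> are functions, not classes; all identities between them are
  stated almost everywhere.\<close>

definition L2 :: "'a measure \<Rightarrow> ('a \<Rightarrow> complex) set" where
  "L2 M = {f \<in> borel_measurable M. integrable M (\<lambda>x. (cmod (f x))\<^sup>2)}"

definition L2_inner :: "'a measure \<Rightarrow> ('a \<Rightarrow> complex) \<Rightarrow> ('a \<Rightarrow> complex) \<Rightarrow> complex" where
  "L2_inner M f g = (LINT x|M. f x * cnj (g x))"

definition L2_norm :: "'a measure \<Rightarrow> ('a \<Rightarrow> complex) \<Rightarrow> real" where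
  "L2_norm M f = sqrt (LINT x|M. (cmod (f x))\<^sup>2)"

definition L2_linear_op ::
  "'a measure \<Rightarrow> ('a \<Rightarrow> complex) set \<Rightarrow> (('a \<Rightarrow> complex) \<Rightarrow> 'a \<Rightarrow> complex) \<Rightarrow> bool" where
  "L2_linear_op M D T \<longleftrightarrow> D \<subseteq> L2 M \<and> (\<lambda>x. 0) \<in> D \<and> (\<forall>f\<in>D. T f \<in> L2 M) \<and>
     (\<forall>f\<in>D. \<forall>g\<in>D. \<forall>a b. (\<lambda>x. a * f x + b * g x) \<in> D \<and>
        (AE x in M. T (\<lambda>x. a * f x + b * g x) x = a * T f x + b * T g x))"

definition L2_bounded_op :: "'a measure \<Rightarrow> (('a \<Rightarrow> complex) \<Rightarrow> 'a \<Rightarrow> complex) \<Rightarrow> bool" where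
  "L2_bounded_op M S \<longleftrightarrow> L2_linear_op M (L2 M) S \<and>
     (\<exists>C. \<forall>f\<in>L2 M. L2_norm M (S f) \<le> C * L2_norm M f)"

definition L2_inverse_op :: "'a measure \<Rightarrow> ('a \<Rightarrow> complex) set \<Rightarrow>
    (('a \<Rightarrow> complex) \<Rightarrow> 'a \<Rightarrow> complex) \<Rightarrow> (('a \<Rightarrow> complex) \<Rightarrow> 'a \<Rightarrow> complex) \<Rightarrow> bool" where
  "L2_inverse_op M D T S \<longleftrightarrow>
     (\<forall>g\<in>L2 M. S g \<in> D \<and> (AE x in M. T (S g) x = g x)) \<and>
     (\<forall>f\<in>D. AE x in M. S (T f) x = f x)"

definition L2_compact_op :: "'a measure \<Rightarrow> (('a \<Rightarrow> complex) \<Rightarrow> 'a \<Rightarrow> complex) \<Rightarrow> bool" where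
  "L2_compact_op M S \<longleftrightarrow> L2_bounded_op M S \<and>
     (\<forall>f :: nat \<Rightarrow> 'a \<Rightarrow> complex. (\<forall>n. f n \<in> L2 M) \<and> bounded (range (\<lambda>n. L2_norm M (f n))) \<longrightarrow>
        (\<exists>r g. strict_mono r \<and> g \<in> L2 M \<and>
           (\<lambda>n. L2_norm M (\<lambda>x. S (f (r n)) x - g x)) \<longlonglongrightarrow> 0))"

text \<open>\<open>z\<close> belongs to the resolvent set of the closure of \<open>T\<close> iff \<open>T - z\<close> is bounded below and has
  dense range; this describes the spectrum of the closed realisation in terms of a core \<open>D\<close>.\<close>

definition L2_spectrum ::
  "'a measure \<Rightarrow> ('a \<Rightarrow> complex) set \<Rightarrow> (('a \<Rightarrow> complex) \<Rightarrow> 'a \<Rightarrow> complex) \<Rightarrow> complex set" where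
  "L2_spectrum M D T = - {z.
     (\<exists>C. \<forall>f\<in>D. L2_norm M f \<le> C * L2_norm M (\<lambda>x. T f x - z * f x)) \<and>
     (\<forall>g\<in>L2 M. \<forall>e>0. \<exists>f\<in>D. L2_norm M (\<lambda>x. T f x - z * f x - g x) < e)}"

text \<open>\<open>g\<close> lies in the domain of the adjoint of \<open>(D, T)\<close> and is mapped to \<open>h\<close>: \<open>g\<close> satisfies the
  boundary conditions conjugate to those defining \<open>D\<close>.\<close>

definition L2_adjoint :: "'a measure \<Rightarrow> ('a \<Rightarrow> complex) set \<Rightarrow>
    (('a \<Rightarrow> complex) \<Rightarrow> 'a \<Rightarrow> complex) \<Rightarrow> ('a \<Rightarrow> complex) \<Rightarrow> ('a \<Rightarrow> complex) \<Rightarrow> bool" where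
  "L2_adjoint M D T g h \<longleftrightarrow> g \<in> L2 M \<and> h \<in> L2 M \<and> (\<forall>f\<in>D. L2_inner M (T f) g = L2_inner M f h)"

definition riesz_basis :: "'a measure \<Rightarrow> 'i set \<Rightarrow> ('i \<Rightarrow> 'a \<Rightarrow> complex) \<Rightarrow> bool" where
  "riesz_basis M I u \<longleftrightarrow> (\<forall>\<xi>\<in>I. u \<xi> \<in> L2 M) \<and>
     (\<forall>f\<in>L2 M. \<forall>e>0. \<exists>F a. finite F \<and> F \<subseteq> I \<and>
        L2_norm M (\<lambda>x. f x - (\<Sum>\<xi>\<in>F. a \<xi> * u \<xi> x)) < e) \<and>
     (\<exists>c C. 0 < c \<and> c \<le> C \<and> (\<forall>F a. finite F \<and> F \<subseteq> I \<longrightarrow>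
        c * (\<Sum>\<xi>\<in>F. (cmod (a \<xi>))\<^sup>2) \<le> (L2_norm M (\<lambda>x. \<Sum>\<xi>\<in>F. a \<xi> * u \<xi> x))\<^sup>2 \<and>
        (L2_norm M (\<lambda>x. \<Sum>\<xi>\<in>F. a \<xi> * u \<xi> x))\<^sup>2 \<le> C * (\<Sum>\<xi>\<in>F. (cmod (a \<xi>))\<^sup>2)))"


section \<open>The boundary value problem and its eigenfunctions\<close>

definition bvp_domain :: "('a, 'd::finite) chart set \<Rightarrow> 'a measure \<Rightarrow> nat \<Rightarrow>
    (('a \<Rightarrow> complex) \<Rightarrow> 'a \<Rightarrow> complex) \<Rightarrow> ('a \<Rightarrow> complex) set \<Rightarrow> ('a \<Rightarrow> complex) set" where
  "bvp_domain A M m L BC = {f \<in> BC. Ck_manifold A m f \<and> f \<in> L2 M \<and> L f \<in> L2 M}"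

definition index_norm :: "int^'l::finite \<Rightarrow> real" where
  "index_norm \<xi> = norm (\<chi> i. real_of_int (\<xi> $ i))"

text \<open>\<open>BC\<close> is the set of functions on \<open>closure \<Omega>\<close> satisfying the (linear) boundary conditions.\<close>

locale nonharmonic_setting =
  fixes \<Omega> :: "'a::t2_space set"
    and A :: "('a, 'd::finite) chart set"
    and M :: "'a measure"
    and m :: nat
    and L :: "('a \<Rightarrow> complex) \<Rightarrow> 'a \<Rightarrow> complex"
    and BC :: "('a \<Rightarrow> complex) set"
    and I :: "(int^'l::finite) set"
    and lam :: "int^'l \<Rightarrow> complex"
    and u v :: "int^'l \<Rightarrow> 'a \<Rightarrow> complex"
  assumes manifold_closure: "compact_manifold_closure TYPE('d) \<Omega>"
    and atlas: "smooth_atlas \<Omega> A"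
    and space_M: "space M = \<Omega>"
    and sets_M: "sets M = sets (restrict_space borel \<Omega>)"
    and normalised: "emeasure M \<Omega> \<noteq> \<infinity> \<Longrightarrow> emeasure M \<Omega> = 1"
    and order_pos: "0 < m"
    and diff_op: "diff_op A m L"
    and BC_zero: "(\<lambda>x. 0) \<in> BC"
    and BC_linear: "\<And>f g a b. f \<in> BC \<Longrightarrow> g \<in> BC \<Longrightarrow> (\<lambda>x. a * f x + b * g x) \<in> BC"
    and BC_cong: "\<And>f g. f \<in> BC \<Longrightarrow> (\<And>x. x \<in> closure \<Omega> \<Longrightarrow> f x = g x) \<Longrightarrow> g \<in> BC"
    and spectrum: "L2_spectrum M (bvp_domain A M m L BC) L = lam ` I"
    and spectrum_discrete: "\<And>z. \<not> z islimpt lam ` I"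
    and u_dom: "\<And>\<xi>. \<xi> \<in> I \<Longrightarrow> u \<xi> \<in> bvp_domain A M m L BC"
    and u_eigen: "\<And>\<xi> x. \<xi> \<in> I \<Longrightarrow> x \<in> \<Omega> \<Longrightarrow> L (u \<xi>) x = lam \<xi> * u \<xi> x"
    and u_riesz: "riesz_basis M I u"
    and v_eigen: "\<And>\<xi>. \<xi> \<in> I \<Longrightarrow>
          L2_adjoint M (bvp_domain A M m L BC) L (v \<xi>) (\<lambda>x. cnj (lam \<xi>) * v \<xi> x)"
    and u_norm: "\<And>\<xi>. \<xi> \<in> I \<Longrightarrow> L2_norm M (u \<xi>) = 1"
    and v_norm: "\<And>\<xi>. \<xi> \<in> I \<Longrightarrow> L2_norm M (v \<xi>) = 1"
    and biorthogonal: "\<And>\<xi> \<eta>. \<xi> \<in> I \<Longrightarrow> \<eta> \<in> I \<Longrightarrow>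
          L2_inner M (u \<xi>) (v \<eta>) = (if \<xi> = \<eta> then 1 else 0)"
    and u_bound: "\<exists>Cb>0. \<exists>\<mu>0>0. \<forall>\<xi>\<in>I. \<forall>x\<in>\<Omega>.
          cmod (u \<xi> x) \<le> Cb * ((1 + (cmod (lam \<xi>))\<^sup>2) powr (1 / (2 * real m))) powr \<mu>0"


section \<open>Pseudo-differential operators\<close>

definition fourier :: "'a measure \<Rightarrow> ('i \<Rightarrow> 'a \<Rightarrow> complex) \<Rightarrow> ('a \<Rightarrow> complex) \<Rightarrow> 'i \<Rightarrow> complex" where
  "fourier M v f \<xi> = (LINT x|M. f x * cnj (v \<xi> x))"

definition ell2 :: "'i set \<Rightarrow> ('i \<Rightarrow> complex) set" where
  "ell2 I = {\<phi>. (\<lambda>\<xi>. (cmod (\<phi> \<xi>))\<^sup>2) summable_on I}"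

text \<open>Determined by \<open>\<phi>\<close> on \<open>I\<close>, up to null sets.\<close>

definition inv_fourier ::
  "'a measure \<Rightarrow> 'i set \<Rightarrow> ('i \<Rightarrow> 'a \<Rightarrow> complex) \<Rightarrow> ('i \<Rightarrow> complex) \<Rightarrow> 'a \<Rightarrow> complex" where
  "inv_fourier M I v \<phi> = (SOME f. f \<in> L2 M \<and> (\<forall>\<xi>\<in>I. fourier M v f \<xi> = \<phi> \<xi>))"

text \<open>The operator as it acts initially on the span of the \<open>u \<xi>\<close>, where the sum is finite.\<close>

definition psdo :: "'a measure \<Rightarrow> 'i set \<Rightarrow> ('i \<Rightarrow> 'a \<Rightarrow> complex) \<Rightarrow> ('i \<Rightarrow> 'a \<Rightarrow> complex) \<Rightarrow>
    ('a \<Rightarrow> 'i \<Rightarrow> complex) \<Rightarrow> ('a \<Rightarrow> complex) \<Rightarrow> 'a \<Rightarrow> complex" where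
  "psdo M I u v \<sigma> f x = (\<Sum>\<^sub>\<infinity>\<xi>\<in>I. \<sigma> x \<xi> * fourier M v f \<xi> * u \<xi> x)"

definition psdo_matrix :: "'a measure \<Rightarrow> 'i set \<Rightarrow> ('i \<Rightarrow> 'a \<Rightarrow> complex) \<Rightarrow> ('i \<Rightarrow> 'a \<Rightarrow> complex) \<Rightarrow>
    ('a \<Rightarrow> 'i \<Rightarrow> complex) \<Rightarrow> 'i \<Rightarrow> 'i \<Rightarrow> complex" where
  "psdo_matrix M I u v \<sigma> \<gamma> \<xi> = L2_inner M (psdo M I u v \<sigma> (u \<xi>)) (v \<gamma>)"

definition matrix_apply :: "'i set \<Rightarrow> ('i \<Rightarrow> 'i \<Rightarrow> complex) \<Rightarrow> ('i \<Rightarrow> complex) \<Rightarrow> 'i \<Rightarrow> complex" where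
  "matrix_apply I B \<phi> \<xi> = (\<Sum>\<^sub>\<infinity>\<eta>\<in>I. B \<xi> \<eta> * \<phi> \<eta>)"

definition matrix_domain :: "'i set \<Rightarrow> ('i \<Rightarrow> 'i \<Rightarrow> complex) \<Rightarrow> ('i \<Rightarrow> complex) set" where
  "matrix_domain I B = {\<phi> \<in> ell2 I. (\<forall>\<xi>\<in>I. (\<lambda>\<eta>. B \<xi> \<eta> * \<phi> \<eta>) summable_on I) \<and>
     matrix_apply I B \<phi> \<in> ell2 I}"

text \<open>The operator in \<open>L2\<close>: conjugation by the Fourier transform of the matrix operator on its
  maximal domain in \<open>ell2\<close>.\<close>

definition psdo_domain :: "'a measure \<Rightarrow> 'i set \<Rightarrow> ('i \<Rightarrow> 'a \<Rightarrow> complex) \<Rightarrow>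
    ('i \<Rightarrow> 'a \<Rightarrow> complex) \<Rightarrow> ('a \<Rightarrow> 'i \<Rightarrow> complex) \<Rightarrow> ('a \<Rightarrow> complex) set" where
  "psdo_domain M I u v \<sigma> = {f \<in> L2 M. fourier M v f \<in> matrix_domain I (psdo_matrix M I u v \<sigma>)}"

definition psdo_L2 :: "'a measure \<Rightarrow> 'i set \<Rightarrow> ('i \<Rightarrow> 'a \<Rightarrow> complex) \<Rightarrow> ('i \<Rightarrow> 'a \<Rightarrow> complex) \<Rightarrow>
    ('a \<Rightarrow> 'i \<Rightarrow> complex) \<Rightarrow> ('a \<Rightarrow> complex) \<Rightarrow> 'a \<Rightarrow> complex" where
  "psdo_L2 M I u v \<sigma> f =
     inv_fourier M I v (matrix_apply I (psdo_matrix M I u v \<sigma>) (fourier M v f))"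

definition symbol_class :: "'a::topological_space set \<Rightarrow> 'a measure \<Rightarrow> 'i set \<Rightarrow>
    ('a \<Rightarrow> 'i \<Rightarrow> complex) set" where
  "symbol_class \<Omega> M I = {\<sigma>.
     (\<lambda>(x, \<xi>). \<sigma> x \<xi>) \<in> borel_measurable (restrict_space borel (closure \<Omega>) \<Otimes>\<^sub>M count_space I) \<and>
     (\<forall>\<xi>\<in>I. (\<lambda>x. \<sigma> x \<xi>) \<in> L2 M)}"

end

theory Submission
  imports Defs "HOL-Complex_Analysis.Great_Picard"
begin

text \<open>Write the matrix of the operator as \<open>B = D + R\<close> with \<open>D\<close> its diagonal.  The column condition
  controls the sum of \<open>R\<close> over the column of \<open>\<xi>\<close> by \<open>\<bar>d \<xi>\<bar>\<close>, the diagonal entry of that same column, so \<open>D\<^sup>-\<^sup>1 R\<close> is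
  not a contraction of unweighted \<open>\<ell>\<^sup>2\<close> in any evident way.  It is one, with constant \<open>q < 1\<close>, in
  the weighted norm \<open>(\<Sum> \<bar>d \<xi>\<bar> \<bar>x \<xi>\<bar>\<^sup>2)\<^sup>1\<^sup>/\<^sup>2\<close>: this is Schur's test, in which the weight makes the row
  and the column condition fit together (\<open>jacobi_weighted_le\<close>).  The row condition alone makes it a contraction
  of \<open>\<ell>\<^sup>\<infinity>\<close> with the same constant (\<open>jacobi_sup_le\<close>).

  The two norms share the work.  Since \<open>\<bar>d\<bar> \<ge> \<delta> > 0\<close>, weighted sequences lie in \<open>\<ell>\<^sup>2\<close>, square summable
  sequences are bounded, and \<open>D\<^sup>-\<^sup>1 y\<close> lies in the weighted space for \<open>y\<close> in \<open>\<ell>\<^sup>2\<close>.  Jacobi iteration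
  for \<open>x = D\<^sup>-\<^sup>1 y - D\<^sup>-\<^sup>1 R x\<close> converges uniformly by the sup norm contraction, and its
  iterates stay in a fixed weighted ball, which is closed under pointwise limits.  So \<open>B x = y\<close> has a
  solution with a weighted bound (\<open>solve\<close>).  It is the only one among all bounded sequences
  (\<open>matrix_apply_inj\<close>), hence on the maximal domain of \<open>B\<close>, on which nothing is known about the
  weighted norm a priori.  The inverse therefore maps \<open>\<ell>\<^sup>2\<close> boundedly into the weighted
  space.  If \<open>\<bar>d\<bar>\<close> tends to infinity, the latter embeds compactly into \<open>\<ell>\<^sup>2\<close>: a weighted bound makes the
  tails uniformly small, and coordinatewise convergence of a subsequence does the rest
  (\<open>op_inv_compact\<close>).

  All this is carried to \<open>L\<^sup>2\<close> by the Fourier transform of the Riesz basis, an isomorphism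
  onto \<open>\<ell>\<^sup>2\<close>: the two frame inequalities pass from finite sums to all functions by density, and surjectivity
  is the completeness of \<open>L\<^sup>2\<close>.\<close>

section \<open>Square integrable functions\<close>

lemma borel_measurable_cnj [measurable (raw)]:
  "f \<in> borel_measurable M \<Longrightarrow> (\<lambda>x. cnj (f x)) \<in> borel_measurable M"
  by (rule measurable_compose[OF _ borel_measurable_continuous_onI[OF continuous_on_cnj[OF continuous_on_id]]])

lemma L2_D:
  assumes "f \<in> L2 M"
  shows "f \<in> borel_measurable M" and "integrable M (\<lambda>x. (cmod (f x))\<^sup>2)"
  using assms by (auto simp: L2_def)

lemma L2_norm_nonneg [simp]: "0 \<le> L2_norm M f"
  by (simp add: L2_norm_def)

lemma L2_norm_power2: "(L2_norm M f)\<^sup>2 = (LINT x|M. (cmod (f x))\<^sup>2)"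
  by (simp add: L2_norm_def)

lemma L2_norm_le_iff:
  assumes "0 \<le> b"
  shows "L2_norm M f \<le> b \<longleftrightarrow> (LINT x|M. (cmod (f x))\<^sup>2) \<le> b\<^sup>2"
  using assms by (metis L2_norm_nonneg L2_norm_power2 abs_le_square_iff abs_of_nonneg)

lemma L2_norm_eq_0_iff:
  assumes "f \<in> L2 M"
  shows "L2_norm M f = 0 \<longleftrightarrow> (AE x in M. f x = 0)"
  using integral_nonneg_eq_0_iff_AE[OF L2_D(2)[OF assms]] by (simp add: L2_norm_def)

lemma L2_integrable_mult_cmod:
  assumes "f \<in> L2 M" "g \<in> L2 M"
  shows "integrable M (\<lambda>x. cmod (f x) * cmod (g x))"
proof (rule Bochner_Integration.integrable_bound)
  show "integrable M (\<lambda>x. (cmod (f x))\<^sup>2 + (cmod (g x))\<^sup>2)"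
    using assms by (simp add: L2_D)
  show "(\<lambda>x. cmod (f x) * cmod (g x)) \<in> borel_measurable M"
    using assms[THEN L2_D(1)] by measurable
  have "cmod (f x) * cmod (g x) \<le> (cmod (f x))\<^sup>2 + (cmod (g x))\<^sup>2" for x
    using sum_squares_bound[of "cmod (f x)" "cmod (g x)"] mult_nonneg_nonneg[OF norm_ge_zero norm_ge_zero, of "f x" "g x"]
    by linarith
  then show "AE x in M. norm (cmod (f x) * cmod (g x)) \<le> norm ((cmod (f x))\<^sup>2 + (cmod (g x))\<^sup>2)"
    by simp
qed

lemma L2_integrable_inner:
  assumes "f \<in> L2 M" "g \<in> L2 M"
  shows "integrable M (\<lambda>x. f x * cnj (g x))"
proof (rule Bochner_Integration.integrable_bound[OF L2_integrable_mult_cmod[OF assms]])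
  show "(\<lambda>x. f x * cnj (g x)) \<in> borel_measurable M"
    using assms[THEN L2_D(1)] by measurable
qed (simp add: norm_mult)

text \<open>Scaling both factors to norm below one reduces the inequality to \<open>2ab \<le> a\<^sup>2 + b\<^sup>2\<close>; scaling by
  numbers slightly larger than the norms avoids dividing by zero.\<close>

lemma L2_cauchy_schwarz:
  assumes f: "f \<in> L2 M" and g: "g \<in> L2 M"
  shows "(LINT x|M. cmod (f x) * cmod (g x)) \<le> L2_norm M f * L2_norm M g" (is "?P \<le> ?a * ?b")
proof -
  have le: "?P \<le> (?a + e) * (?b + e)" if "0 < e" for e
  proof -
    define s t where "s = ?a + e" and "t = ?b + e"
    have st: "0 < s" "0 < t" "?a \<le> s" "?b \<le> t"
      using that by (simp_all add: s_def t_def add_nonneg_pos)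
    have "?P \<le> (LINT x|M. (t / (2 * s)) * (cmod (f x))\<^sup>2 + (s / (2 * t)) * (cmod (g x))\<^sup>2)"
    proof (rule integral_mono)
      fix x
      have "2 * (t * cmod (f x)) * (s * cmod (g x)) \<le> (t * cmod (f x))\<^sup>2 + (s * cmod (g x))\<^sup>2"
        by (rule sum_squares_bound)
      then show "cmod (f x) * cmod (g x)
          \<le> (t / (2 * s)) * (cmod (f x))\<^sup>2 + (s / (2 * t)) * (cmod (g x))\<^sup>2"
        using st by (simp add: field_simps power2_eq_square)
    qed (use f g in \<open>simp_all add: L2_D L2_integrable_mult_cmod\<close>)
    also have "\<dots> = (t / (2 * s)) * ?a\<^sup>2 + (s / (2 * t)) * ?b\<^sup>2"
      using f g by (simp add: L2_norm_power2 L2_D)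
    also have "\<dots> \<le> (t / (2 * s)) * s\<^sup>2 + (s / (2 * t)) * t\<^sup>2"
      using st by (intro add_mono mult_left_mono power_mono) auto
    also have "\<dots> = s * t"
      using st by (simp add: field_simps power2_eq_square)
    finally show ?thesis by (simp add: s_def t_def)
  qed
  have "((\<lambda>e. (?a + e) * (?b + e)) \<longlongrightarrow> (?a + 0) * (?b + 0)) (at_right 0)"
    by (intro tendsto_intros)
  moreover have "\<forall>\<^sub>F e in at_right 0. ?P \<le> (?a + e) * (?b + e)"
    using le eventually_at_right_less by (rule eventually_mono[rotated])
  ultimately show ?thesis
    using tendsto_lowerbound[of "\<lambda>e. (?a + e) * (?b + e)" _ "at_right 0" ?P] by auto
qed

lemma L2_inner_le:
  assumes "f \<in> L2 M" "g \<in> L2 M"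
  shows "cmod (L2_inner M f g) \<le> L2_norm M f * L2_norm M g"
proof -
  have "cmod (L2_inner M f g) \<le> (LINT x|M. cmod (f x * cnj (g x)))"
    unfolding L2_inner_def by (rule integral_norm_bound)
  then show ?thesis
    using L2_cauchy_schwarz[OF assms] by (simp add: norm_mult)
qed

lemma L2_inner_lincomb:
  assumes "f \<in> L2 M" "g \<in> L2 M" "h \<in> L2 M"
  shows "L2_inner M (\<lambda>x. a * f x + b * g x) h = a * L2_inner M f h + b * L2_inner M g h"
proof -
  note i = L2_integrable_inner[OF assms(1,3)] L2_integrable_inner[OF assms(2,3)]
  have "L2_inner M (\<lambda>x. a * f x + b * g x) h
      = (LINT x|M. a * (f x * cnj (h x)) + b * (g x * cnj (h x)))"
    unfolding L2_inner_def by (simp add: algebra_simps)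
  then show ?thesis using i by (simp add: L2_inner_def)
qed

lemma L2_zero [simp]: "(\<lambda>x. 0) \<in> L2 M"
  by (simp add: L2_def)

lemma L2_norm_zero [simp]: "L2_norm M (\<lambda>x. 0) = 0"
  by (simp add: L2_norm_def)

lemma L2_scale: "f \<in> L2 M \<Longrightarrow> (\<lambda>x. a * f x) \<in> L2 M"
  by (auto simp: L2_def norm_mult power_mult_distrib)

lemma L2_add:
  assumes "f \<in> L2 M" "g \<in> L2 M"
  shows "(\<lambda>x. f x + g x) \<in> L2 M"
proof -
  note [measurable] = assms[THEN L2_D(1)]
  have "integrable M (\<lambda>x. (cmod (f x))\<^sup>2 + 2 * (cmod (f x) * cmod (g x)) + (cmod (g x))\<^sup>2)"
    using assms by (simp add: L2_D L2_integrable_mult_cmod)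
  moreover have "(cmod (f x + g x))\<^sup>2
      \<le> (cmod (f x))\<^sup>2 + 2 * (cmod (f x) * cmod (g x)) + (cmod (g x))\<^sup>2" for x
    using power_mono[OF norm_triangle_ineq[of "f x" "g x"], of 2]
    by (simp add: power2_sum algebra_simps)
  ultimately have "integrable M (\<lambda>x. (cmod (f x + g x))\<^sup>2)"
    by (elim Bochner_Integration.integrable_bound) (auto intro: order_trans[OF _ abs_ge_self])
  then show ?thesis by (auto simp: L2_def)
qed

lemma L2_lincomb:
  assumes "f \<in> L2 M" "g \<in> L2 M"
  shows "(\<lambda>x. a * f x + b * g x) \<in> L2 M"
  using assms by (intro L2_add L2_scale)

lemma L2_diff:
  assumes "f \<in> L2 M" "g \<in> L2 M"
  shows "(\<lambda>x. f x - g x) \<in> L2 M"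
  using L2_lincomb[OF assms, of 1 "-1"] by simp

lemma L2_sum:
  assumes "\<And>i. i \<in> F \<Longrightarrow> f i \<in> L2 M"
  shows "(\<lambda>x. \<Sum>i\<in>F. f i x) \<in> L2 M"
  using assms by (induction F rule: infinite_finite_induct) (auto intro: L2_add)

lemma L2_triangle:
  assumes "f \<in> L2 M" "g \<in> L2 M"
  shows "L2_norm M (\<lambda>x. f x + g x) \<le> L2_norm M f + L2_norm M g"
proof -
  have "(LINT x|M. (cmod (f x + g x))\<^sup>2)
      \<le> (LINT x|M. (cmod (f x))\<^sup>2 + 2 * (cmod (f x) * cmod (g x)) + (cmod (g x))\<^sup>2)"
  proof (rule integral_mono)
    show "integrable M (\<lambda>x. (cmod (f x + g x))\<^sup>2)"
      using L2_add[OF assms] by (rule L2_D)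
    show "(cmod (f x + g x))\<^sup>2
      \<le> (cmod (f x))\<^sup>2 + 2 * (cmod (f x) * cmod (g x)) + (cmod (g x))\<^sup>2" for x
      using power_mono[OF norm_triangle_ineq[of "f x" "g x"], of 2]
      by (simp add: power2_sum algebra_simps)
  qed (use assms in \<open>simp_all add: L2_D L2_integrable_mult_cmod\<close>)
  also have "\<dots> = (L2_norm M f)\<^sup>2 + 2 * (LINT x|M. cmod (f x) * cmod (g x)) + (L2_norm M g)\<^sup>2"
    using assms by (simp add: L2_norm_power2 L2_D L2_integrable_mult_cmod)
  also have "\<dots> \<le> (L2_norm M f + L2_norm M g)\<^sup>2"
    using L2_cauchy_schwarz[OF assms] by (simp add: power2_sum)
  finally show ?thesis by (simp add: L2_norm_le_iff)
qed

lemma L2_norm_minus_commute: "L2_norm M (\<lambda>x. f x - g x) = L2_norm M (\<lambda>x. g x - f x)"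
  by (simp add: L2_norm_def norm_minus_commute)

lemma L2_triangle_le:
  assumes "f \<in> L2 M" "g \<in> L2 M"
  shows "L2_norm M f \<le> L2_norm M (\<lambda>x. f x - g x) + L2_norm M g"
  using L2_triangle[OF L2_diff[OF assms] assms(2)] by simp

lemma L2_triangle_diff:
  assumes "f \<in> L2 M" "g \<in> L2 M" "h \<in> L2 M"
  shows "L2_norm M (\<lambda>x. f x - h x) \<le> L2_norm M (\<lambda>x. f x - g x) + L2_norm M (\<lambda>x. g x - h x)"
  using L2_triangle[OF L2_diff[OF assms(1,2)] L2_diff[OF assms(2,3)]] by simp

lemma L2_norm_sum_le:
  assumes "\<And>i. i \<in> F \<Longrightarrow> f i \<in> L2 M"
  shows "L2_norm M (\<lambda>x. \<Sum>i\<in>F. f i x) \<le> (\<Sum>i\<in>F. L2_norm M (f i))"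
  using assms
proof (induction F rule: infinite_finite_induct)
  case (insert i F)
  then have "L2_norm M (\<lambda>x. f i x + (\<Sum>j\<in>F. f j x)) \<le> L2_norm M (f i) + (\<Sum>j\<in>F. L2_norm M (f j))"
    by (intro order_trans[OF L2_triangle] add_mono L2_sum) auto
  then show ?case using insert by simp
qed auto

text \<open>A sequence with summable increments is dominated by the sum of the moduli of its increments,
  whose square is integrable by monotone convergence; hence it converges almost everywhere, and
  Fatou's lemma upgrades this to convergence in norm.\<close>

lemma L2_complete:
  assumes f: "\<And>n. f n \<in> L2 M" and b: "summable b"
    and incr: "\<And>n. L2_norm M (\<lambda>x. f (Suc n) x - f n x) \<le> b n"
  obtains g where "g \<in> L2 M" "(\<lambda>n. L2_norm M (\<lambda>x. f n x - g x)) \<longlonglongrightarrow> 0"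
proof -
  note [measurable] = f[THEN L2_D(1)]
  define g where "g x = lim (\<lambda>n. f n x)" for x
  have [measurable]: "g \<in> borel_measurable M"
    unfolding g_def by measurable
  define tail where "tail n = suminf b - sum b {..<n}" for n
  have b0: "0 \<le> b n" for n
    using order_trans[OF L2_norm_nonneg incr] .
  have tail0: "0 \<le> tail n" for n
    unfolding tail_def using sum_le_suminf[OF b, of "{..<n}"] b0 by simp
  define h where "h n x = complex_of_real (\<Sum>k<n. cmod (f (Suc k) x - f k x))" for n x
  have hL2: "h n \<in> L2 M" for n
    unfolding h_def of_real_sum
  proof (rule L2_sum)
    show "(\<lambda>x. complex_of_real (cmod (f (Suc k) x - f k x))) \<in> L2 M" for k
      using L2_diff[OF f f, of "Suc k" k] by (auto simp: L2_def)
  qed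
  have h_norm: "L2_norm M (h n) \<le> suminf b" for n
  proof -
    have "L2_norm M (h n) \<le> (\<Sum>k<n. L2_norm M (\<lambda>x. complex_of_real (cmod (f (Suc k) x - f k x))))"
      unfolding h_def of_real_sum
    proof (rule L2_norm_sum_le)
      show "(\<lambda>x. complex_of_real (cmod (f (Suc k) x - f k x))) \<in> L2 M" for k
        using L2_diff[OF f f, of "Suc k" k] by (auto simp: L2_def)
    qed
    also have "\<dots> \<le> (\<Sum>k<n. b k)"
      using incr by (intro sum_mono) (simp add: L2_norm_def)
    also have "\<dots> \<le> suminf b"
      using sum_le_suminf[OF b] b0 by simp
    finally show ?thesis .
  qed
  have hint: "(\<integral>\<^sup>+x. ennreal ((cmod (h n x))\<^sup>2) \<partial>M) \<le> ennreal ((suminf b)\<^sup>2)" for n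
    using h_norm[of n] suminf_nonneg[OF b] b0 hL2[of n]
    by (subst nn_integral_eq_integral) (auto dest: L2_D simp: L2_norm_le_iff intro: ennreal_leI)
  have AE_conv: "AE x in M. convergent (\<lambda>n. f n x)"
  proof -
    note [measurable] = hL2[THEN L2_D(1)]
    have "(\<integral>\<^sup>+x. (SUP n. ennreal ((cmod (h n x))\<^sup>2)) \<partial>M) = (SUP n. \<integral>\<^sup>+x. ennreal ((cmod (h n x))\<^sup>2) \<partial>M)"
    proof (rule nn_integral_monotone_convergence_SUP)
      show "incseq (\<lambda>n x. ennreal ((cmod (h n x))\<^sup>2))"
        by (intro incseq_SucI le_funI ennreal_leI power_mono)
          (auto simp: h_def sum_nonneg simp del: of_real_sum of_real_add simp flip: of_real_add)
    qed measurable
    also have "\<dots> \<le> ennreal ((suminf b)\<^sup>2)"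
      using hint by (intro SUP_least)
    finally have "(\<integral>\<^sup>+x. (SUP n. ennreal ((cmod (h n x))\<^sup>2)) \<partial>M) \<noteq> \<infinity>"
      by (auto simp: top_unique)
    then have "AE x in M. (SUP n. ennreal ((cmod (h n x))\<^sup>2)) \<noteq> \<infinity>"
      by (intro nn_integral_PInf_AE) measurable
    then show ?thesis
    proof (rule AE_mp, intro AE_I2 impI)
      fix x assume fin: "(SUP n. ennreal ((cmod (h n x))\<^sup>2)) \<noteq> \<infinity>"
      then obtain r where r: "0 \<le> r" "(SUP n. ennreal ((cmod (h n x))\<^sup>2)) = ennreal r"
        by (metis ennreal_cases infinity_ennreal_def)
      have "ennreal ((cmod (h n x))\<^sup>2) \<le> ennreal r" for n
        using SUP_upper[of n UNIV "\<lambda>n. ennreal ((cmod (h n x))\<^sup>2)"] r by simp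
      then have "cmod (h n x) \<le> sqrt r" for n
        using r by (simp add: real_le_rsqrt)
      then have "(\<Sum>k<n. norm (f (Suc k) x - f k x)) \<le> sqrt r" for n
        by (simp add: h_def sum_nonneg del: of_real_sum)
      then have "summable (\<lambda>k. norm (f (Suc k) x - f k x))"
        by (intro bounded_imp_summable[where B="sqrt r"]) (auto simp: lessThan_Suc_atMost[symmetric] simp del: sum.lessThan_Suc)
      then have "summable (\<lambda>k. f (Suc k) x - f k x)"
        by (rule summable_norm_cancel)
      then have "convergent (\<lambda>n. f 0 x + (\<Sum>k<n. f (Suc k) x - f k x))"
        by (intro convergent_add convergent_const) (simp add: summable_iff_convergent)
      then show "convergent (\<lambda>n. f n x)"
        by (subst (asm) sum_lessThan_telescope) simp
    qed
  qed
  have fdiff: "L2_norm M (\<lambda>x. f (n + k) x - f n x) \<le> tail n" for n k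
  proof -
    have "L2_norm M (\<lambda>x. f (n + k) x - f n x) \<le> (\<Sum>j<k. b (n + j))"
    proof (induction k)
      case (Suc k)
      show ?case
        using L2_triangle_diff[OF f[of "n + Suc k"] f[of "n + k"] f[of n]] incr[of "n + k"] Suc by simp
    qed simp
    also have "\<dots> = sum b {n..<n + k}"
      using sum.shift_bounds_nat_ivl[of b 0 n k] by (simp add: atLeast0LessThan add.commute)
    also have "\<dots> = sum b {..<n + k} - sum b {..<n}"
      using sum_diff[of "{..<n + k}" "{..<n}" b] by (simp add: lessThan_minus_lessThan)
    also have "\<dots> \<le> tail n"
      unfolding tail_def using sum_le_suminf[OF b, of "{..<n + k}"] b0 by simp
    finally show ?thesis .
  qed
  have fatou: "(\<integral>\<^sup>+x. ennreal ((cmod (g x - f n x))\<^sup>2) \<partial>M) \<le> ennreal ((tail n)\<^sup>2)" for n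
  proof -
    have "(\<integral>\<^sup>+x. ennreal ((cmod (g x - f n x))\<^sup>2) \<partial>M)
        = (\<integral>\<^sup>+x. liminf (\<lambda>k. ennreal ((cmod (f (n + k) x - f n x))\<^sup>2)) \<partial>M)"
    proof (rule nn_integral_cong_AE, rule AE_mp[OF AE_conv], intro AE_I2 impI)
      fix x assume "convergent (\<lambda>n. f n x)"
      then have "(\<lambda>n. f n x) \<longlonglongrightarrow> g x"
        by (simp add: g_def convergent_LIMSEQ_iff)
      then have "(\<lambda>k. f (n + k) x) \<longlonglongrightarrow> g x"
        using LIMSEQ_ignore_initial_segment[of "\<lambda>n. f n x" "g x" n] by (simp add: add.commute)
      then have "(\<lambda>k. ennreal ((cmod (f (n + k) x - f n x))\<^sup>2)) \<longlonglongrightarrow> ennreal ((cmod (g x - f n x))\<^sup>2)"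
        by (intro tendsto_intros)
      then show "ennreal ((cmod (g x - f n x))\<^sup>2) = liminf (\<lambda>k. ennreal ((cmod (f (n + k) x - f n x))\<^sup>2))"
        by (intro lim_imp_Liminf[symmetric]) simp_all
    qed
    also have "\<dots> \<le> liminf (\<lambda>k. \<integral>\<^sup>+x. ennreal ((cmod (f (n + k) x - f n x))\<^sup>2) \<partial>M)"
      by (rule nn_integral_liminf) measurable
    also have "\<dots> \<le> ennreal ((tail n)\<^sup>2)"
    proof -
      have "(\<integral>\<^sup>+x. ennreal ((cmod (f (n + k) x - f n x))\<^sup>2) \<partial>M) \<le> ennreal ((tail n)\<^sup>2)" for k
        using fdiff[of n k] tail0[of n] L2_diff[OF f f, of "n + k" n]
        by (subst nn_integral_eq_integral) (auto dest: L2_D simp: L2_norm_le_iff intro: ennreal_leI)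
      then show ?thesis
        by (intro Liminf_le[THEN order_trans]) (auto intro!: always_eventually)
    qed
    finally show ?thesis .
  qed
  have gf: "(\<lambda>x. g x - f n x) \<in> L2 M" for n
  proof -
    have "(\<integral>\<^sup>+x. ennreal (norm ((cmod (g x - f n x))\<^sup>2)) \<partial>M) < \<infinity>"
      using fatou[of n] by (simp add: le_less_trans)
    then have "integrable M (\<lambda>x. (cmod (g x - f n x))\<^sup>2)"
      by (intro integrableI_bounded) measurable
    then show ?thesis by (simp add: L2_def)
  qed
  show ?thesis
  proof (rule that)
    show "g \<in> L2 M"
      using L2_add[OF gf f, of 0 0] by simp
    have "L2_norm M (\<lambda>x. f n x - g x) \<le> tail n" for n
    proof -
      have "ennreal (LINT x|M. (cmod (g x - f n x))\<^sup>2) \<le> ennreal ((tail n)\<^sup>2)"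
        using fatou[of n] gf[of n] by (subst nn_integral_eq_integral[symmetric]) (auto dest: L2_D)
      then show ?thesis
        using tail0[of n] by (subst L2_norm_minus_commute) (simp add: L2_norm_le_iff)
    qed
    moreover have "tail \<longlonglongrightarrow> 0"
      using tendsto_diff[OF tendsto_const[of "suminf b"] summable_LIMSEQ[OF b]]
      unfolding tail_def[abs_def] by simp
    ultimately show "(\<lambda>n. L2_norm M (\<lambda>x. f n x - g x)) \<longlonglongrightarrow> 0"
      by (elim Lim_null_comparison[rotated]) (simp add: always_eventually)
  qed
qed

section \<open>Diagonally dominant matrices\<close>

lemma summable_on_nonneg_bounded:
  fixes f :: "'i \<Rightarrow> real"
  assumes "\<And>x. x \<in> A \<Longrightarrow> 0 \<le> f x" "\<And>F. finite F \<Longrightarrow> F \<subseteq> A \<Longrightarrow> sum f F \<le> b"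
  shows "f summable_on A"
  using assms by (intro nonneg_bdd_above_summable_on) (auto intro!: bdd_aboveI2[where M=b])

text \<open>Bounds on square sums are kept as bounds over all finite index sets: these survive
  pointwise limits and need no summability side conditions.\<close>

lemma ell2_I:
  assumes "\<And>F. finite F \<Longrightarrow> F \<subseteq> I \<Longrightarrow> (\<Sum>i\<in>F. (cmod (x i))\<^sup>2) \<le> b"
  shows "x \<in> ell2 I"
  unfolding ell2_def using assms by (auto intro: summable_on_nonneg_bounded[where b=b])

lemma ell2_cong: "(\<And>i. i \<in> I \<Longrightarrow> x i = y i) \<Longrightarrow> x \<in> ell2 I \<longleftrightarrow> y \<in> ell2 I"
  unfolding ell2_def by (auto cong: summable_on_cong)

lemma ell2_lincomb:
  assumes "x \<in> ell2 I" "y \<in> ell2 I"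
  shows "(\<lambda>i. a * x i + b * y i) \<in> ell2 I"
  unfolding ell2_def
proof (rule CollectI, rule summable_on_comparison_test)
  show "(\<lambda>i. (2 * (cmod a)\<^sup>2) * (cmod (x i))\<^sup>2 + (2 * (cmod b)\<^sup>2) * (cmod (y i))\<^sup>2) summable_on I"
    using assms by (intro summable_on_add summable_on_cmult_right) (auto simp: ell2_def)
  show "(cmod (a * x i + b * y i))\<^sup>2
      \<le> (2 * (cmod a)\<^sup>2) * (cmod (x i))\<^sup>2 + (2 * (cmod b)\<^sup>2) * (cmod (y i))\<^sup>2" for i
  proof -
    have "(cmod (a * x i + b * y i))\<^sup>2 \<le> (cmod (a * x i) + cmod (b * y i))\<^sup>2"
      by (intro power_mono norm_triangle_ineq) auto
    also have "\<dots> \<le> 2 * (cmod (a * x i))\<^sup>2 + 2 * (cmod (b * y i))\<^sup>2"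
      using sum_squares_bound[of "cmod (a * x i)" "cmod (b * y i)"] by (simp add: power2_sum)
    finally show ?thesis by (simp add: norm_mult power_mult_distrib mult.assoc)
  qed
qed simp

lemma matrix_apply_cong: "(\<And>i. i \<in> I \<Longrightarrow> x i = y i) \<Longrightarrow> matrix_apply I B x i = matrix_apply I B y i"
  unfolding matrix_apply_def by (auto cong: infsum_cong)

locale diag_dominant =
  fixes I :: "'i set" and B :: "'i \<Rightarrow> 'i \<Rightarrow> complex" and \<delta> q :: real
  assumes delta_pos: "0 < \<delta>"
    and q_nonneg: "0 \<le> q" and q_less_1: "q < 1"
    and diag_ge: "\<And>i. i \<in> I \<Longrightarrow> \<delta> \<le> cmod (B i i)"
    and row_sum: "\<And>i F. i \<in> I \<Longrightarrow> finite F \<Longrightarrow> F \<subseteq> I - {i} \<Longrightarrow>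
          (\<Sum>j\<in>F. cmod (B i j)) \<le> q * cmod (B i i)"
    and col_sum: "\<And>j F. j \<in> I \<Longrightarrow> finite F \<Longrightarrow> F \<subseteq> I - {j} \<Longrightarrow>
          (\<Sum>i\<in>F. cmod (B i j)) \<le> q * cmod (B j j)"
begin

text \<open>The operator \<open>D\<^sup>-\<^sup>1 R\<close>, where \<open>D\<close> and \<open>R\<close> are the diagonal and the off-diagonal
  part of \<open>B\<close>; up to sign it is the iteration operator of Jacobi's method.\<close>

definition jacobi :: "('i \<Rightarrow> complex) \<Rightarrow> 'i \<Rightarrow> complex" where
  "jacobi x i = (\<Sum>\<^sub>\<infinity>j\<in>I - {i}. B i j * x j) / B i i"

text \<open>The bound \<open>\<parallel>x\<parallel> \<le> b\<close> in the \<open>\<ell>\<^sup>2\<close> norm with weight \<open>\<bar>B i i\<bar>\<close>, as a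
  relation, so that it also expresses that the norm is finite.\<close>

definition weighted_le :: "('i \<Rightarrow> complex) \<Rightarrow> real \<Rightarrow> bool" where
  "weighted_le x b \<longleftrightarrow> (\<forall>F. finite F \<and> F \<subseteq> I \<longrightarrow> (\<Sum>i\<in>F. cmod (B i i) * (cmod (x i))\<^sup>2) \<le> b\<^sup>2)"

lemma diag_pos: "i \<in> I \<Longrightarrow> 0 < cmod (B i i)"
  using diag_ge delta_pos by (meson less_le_trans)

lemma diag_nz: "i \<in> I \<Longrightarrow> B i i \<noteq> 0"
  using diag_pos by fastforce

lemma row_summable: "i \<in> I \<Longrightarrow> (\<lambda>j. cmod (B i j)) summable_on (I - {i})"
  by (rule summable_on_nonneg_bounded) (auto intro: row_sum)

lemma row_infsum_le: "i \<in> I \<Longrightarrow> (\<Sum>\<^sub>\<infinity>j\<in>I - {i}. cmod (B i j)) \<le> q * cmod (B i i)"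
  by (rule infsum_le_finite_sums[OF row_summable]) (auto intro: row_sum)

lemma off_diag_abs_summable:
  assumes "i \<in> I" "\<And>j. j \<in> I \<Longrightarrow> cmod (x j) \<le> c"
  shows "(\<lambda>j. cmod (B i j * x j)) summable_on (I - {i})"
proof (rule summable_on_comparison_test)
  show "(\<lambda>j. cmod (B i j) * c) summable_on (I - {i})"
    using row_summable[OF assms(1)] by (rule summable_on_cmult_left)
qed (use assms(2) in \<open>auto simp: norm_mult intro: mult_left_mono\<close>)

lemma off_diag_summable:
  assumes "i \<in> I" "\<And>j. j \<in> I \<Longrightarrow> cmod (x j) \<le> c"
  shows "(\<lambda>j. B i j * x j) summable_on (I - {i})"
  using off_diag_abs_summable[OF assms] by (rule abs_summable_summable)

lemma full_row_summable:
  assumes "i \<in> I" "\<And>j. j \<in> I \<Longrightarrow> cmod (x j) \<le> c"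
  shows "(\<lambda>j. B i j * x j) summable_on I"
proof -
  have "(\<lambda>j. B i j * x j) summable_on insert i (I - {i})"
    unfolding summable_on_insert_iff using assms by (rule off_diag_summable)
  moreover have "insert i (I - {i}) = I"
    using assms(1) by blast
  ultimately show ?thesis by simp
qed

lemma matrix_apply_eq:
  assumes "i \<in> I" "\<And>j. j \<in> I \<Longrightarrow> cmod (x j) \<le> c"
  shows "matrix_apply I B x i = B i i * (x i + jacobi x i)"
proof -
  have "matrix_apply I B x i = (\<Sum>\<^sub>\<infinity>j\<in>insert i (I - {i}). B i j * x j)"
    using assms(1) by (simp add: matrix_apply_def insert_absorb)
  also have "\<dots> = B i i * x i + (\<Sum>\<^sub>\<infinity>j\<in>I - {i}. B i j * x j)"
    by (rule infsum_insert[OF off_diag_summable[OF assms]]) auto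
  also have "\<dots> = B i i * (x i + jacobi x i)"
    using diag_nz[OF assms(1)] by (simp add: jacobi_def field_simps)
  finally show ?thesis .
qed

lemma matrix_apply_lincomb:
  assumes i: "i \<in> I" and x: "\<And>j. j \<in> I \<Longrightarrow> cmod (x j) \<le> c" and y: "\<And>j. j \<in> I \<Longrightarrow> cmod (y j) \<le> c'"
  shows "matrix_apply I B (\<lambda>j. a * x j + b * y j) i = a * matrix_apply I B x i + b * matrix_apply I B y i"
proof -
  note s = full_row_summable[OF i x] full_row_summable[OF i y]
  have "matrix_apply I B (\<lambda>j. a * x j + b * y j) i
      = (\<Sum>\<^sub>\<infinity>j\<in>I. a * (B i j * x j) + b * (B i j * y j))"
    unfolding matrix_apply_def by (simp add: algebra_simps)
  also have "\<dots> = (\<Sum>\<^sub>\<infinity>j\<in>I. a * (B i j * x j)) + (\<Sum>\<^sub>\<infinity>j\<in>I. b * (B i j * y j))"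
    using s by (intro infsum_add summable_on_cmult_right)
  also have "\<dots> = a * matrix_apply I B x i + b * matrix_apply I B y i"
    using s unfolding matrix_apply_def by (simp add: infsum_cmult_right)
  finally show ?thesis .
qed

lemma jacobi_diff:
  assumes "i \<in> I" "\<And>j. j \<in> I \<Longrightarrow> cmod (x j) \<le> c" "\<And>j. j \<in> I \<Longrightarrow> cmod (y j) \<le> c'"
  shows "jacobi (\<lambda>j. x j - y j) i = jacobi x i - jacobi y i"
proof -
  have "cmod (- y j) \<le> c'" if "j \<in> I" for j
    using assms(3)[OF that] by simp
  then show ?thesis
    using infsum_add[OF off_diag_summable[OF assms(1,2)] off_diag_summable[OF assms(1), of "\<lambda>j. - y j" c']]
    by (simp add: jacobi_def right_diff_distrib infsum_uminus diff_divide_distrib)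
qed

lemma jacobi_sup_le:
  assumes i: "i \<in> I" and c: "\<And>j. j \<in> I \<Longrightarrow> cmod (x j) \<le> c"
  shows "cmod (jacobi x i) \<le> q * c"
proof -
  have c0: "0 \<le> c" using c[OF i] norm_ge_zero order_trans by blast
  have "cmod (\<Sum>\<^sub>\<infinity>j\<in>I - {i}. B i j * x j) \<le> (\<Sum>\<^sub>\<infinity>j\<in>I - {i}. cmod (B i j * x j))"
    by (rule norm_infsum_bound[OF off_diag_abs_summable[OF assms]])
  also have "\<dots> \<le> (\<Sum>\<^sub>\<infinity>j\<in>I - {i}. cmod (B i j) * c)"
    using off_diag_abs_summable[OF assms] summable_on_cmult_left[OF row_summable[OF i]]
    by (rule infsum_mono) (use c in \<open>auto simp: norm_mult intro: mult_left_mono\<close>)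
  also have "\<dots> = (\<Sum>\<^sub>\<infinity>j\<in>I - {i}. cmod (B i j)) * c"
    by (rule infsum_cmult_left) (use row_summable[OF i] in auto)
  also have "\<dots> \<le> q * cmod (B i i) * c"
    using row_infsum_le[OF i] c0 by (rule mult_right_mono)
  finally show ?thesis
    using diag_pos[OF i] by (simp add: jacobi_def norm_divide divide_simps mult_ac)
qed

lemma weighted_le_sum:
  assumes "weighted_le x b" "finite F" "F \<subseteq> I" "0 < k" "\<And>i. i \<in> F \<Longrightarrow> k \<le> cmod (B i i)"
  shows "(\<Sum>i\<in>F. (cmod (x i))\<^sup>2) \<le> b\<^sup>2 / k"
proof -
  have "k * (\<Sum>i\<in>F. (cmod (x i))\<^sup>2) \<le> (\<Sum>i\<in>F. cmod (B i i) * (cmod (x i))\<^sup>2)"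
    unfolding sum_distrib_left using assms by (intro sum_mono mult_right_mono) auto
  also have "\<dots> \<le> b\<^sup>2"
    using assms by (simp add: weighted_le_def)
  finally show ?thesis using assms(4) by (simp add: field_simps)
qed

lemma weighted_le_ell2: "weighted_le x b \<Longrightarrow> x \<in> ell2 I"
  using weighted_le_sum[OF _ _ _ delta_pos] diag_ge by (intro ell2_I[where b="b\<^sup>2 / \<delta>"]) blast

lemma weighted_le_cong: "(\<And>i. i \<in> I \<Longrightarrow> x i = y i) \<Longrightarrow> weighted_le x b \<longleftrightarrow> weighted_le y b"
  unfolding weighted_le_def by (intro all_cong arg_cong2[where f="(\<le>)"] sum.cong) auto

lemma weighted_le_mono: "weighted_le x b \<Longrightarrow> 0 \<le> b \<Longrightarrow> b \<le> b' \<Longrightarrow> weighted_le x b'"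
  unfolding weighted_le_def by (meson order_trans power_mono)

lemma weighted_le_lim:
  assumes "\<And>n. weighted_le (X n) b" "\<And>i. i \<in> I \<Longrightarrow> (\<lambda>n. X n i) \<longlonglongrightarrow> x i"
  shows "weighted_le x b"
  unfolding weighted_le_def
proof safe
  fix F assume F: "finite F" "F \<subseteq> I"
  have "(\<lambda>n. \<Sum>i\<in>F. cmod (B i i) * (cmod (X n i))\<^sup>2) \<longlonglongrightarrow> (\<Sum>i\<in>F. cmod (B i i) * (cmod (x i))\<^sup>2)"
    using F by (intro tendsto_intros assms(2)) auto
  then show "(\<Sum>i\<in>F. cmod (B i i) * (cmod (x i))\<^sup>2) \<le> b\<^sup>2"
    by (rule tendsto_upperbound) (use assms(1) F in \<open>auto simp: weighted_le_def\<close>)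
qed

lemma weighted_le_sup:
  assumes "weighted_le x b" "0 \<le> b" "i \<in> I"
  shows "cmod (x i) \<le> b / sqrt \<delta>"
proof -
  have "\<delta> * (cmod (x i))\<^sup>2 \<le> cmod (B i i) * (cmod (x i))\<^sup>2"
    using diag_ge[OF assms(3)] by (intro mult_right_mono) auto
  also have "\<dots> \<le> b\<^sup>2"
    using assms(1)[unfolded weighted_le_def, rule_format, of "{i}"] assms(3) by simp
  finally have "(sqrt \<delta> * cmod (x i))\<^sup>2 \<le> b\<^sup>2"
    using delta_pos by (simp add: power_mult_distrib)
  then have "sqrt \<delta> * cmod (x i) \<le> b"
    using assms(2) by (rule power2_le_imp_le)
  then show ?thesis
    using delta_pos by (simp add: field_simps)
qed

text \<open>Schur's test.  On a finite section, splitting \<open>\<bar>B i j\<bar>\<close> as a product of square roots and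
  applying Cauchy--Schwarz to each row costs a factor \<open>q \<bar>B i i\<bar>\<close>.  The division by the diagonal and
  the weight together contribute \<open>1 / \<bar>B i i\<bar>\<close>, so only \<open>q\<close> remains; after exchanging the sums, the column condition turns
  what remains into \<open>q \<bar>B j j\<bar> \<bar>x j\<bar>\<^sup>2\<close>, the weighted sum again.  The rows are then completed
  by a limit over finite sections.\<close>

lemma jacobi_weighted_le:
  assumes b: "0 \<le> b" and x: "weighted_le x b"
  shows "weighted_le (jacobi x) (q * b)"
  unfolding weighted_le_def
proof safe
  fix F assume F: "finite F" "F \<subseteq> I"
  define p where "p G i = (\<Sum>j\<in>G - {i}. B i j * x j)" for G i
  have finite_section: "(\<Sum>i\<in>F. (cmod (p G i))\<^sup>2 / cmod (B i i)) \<le> (q * b)\<^sup>2"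
    if G: "finite G" "G \<subseteq> I" for G
  proof -
    have row: "(cmod (p G i))\<^sup>2 / cmod (B i i) \<le> q * (\<Sum>j\<in>G - {i}. cmod (B i j) * (cmod (x j))\<^sup>2)"
      if i: "i \<in> I" for i
    proof -
      let ?r = "\<lambda>j. sqrt (cmod (B i j))"
      have "cmod (p G i) \<le> (\<Sum>j\<in>G - {i}. ?r j * (?r j * cmod (x j)))"
        unfolding p_def by (rule order_trans[OF norm_sum]) (simp add: norm_mult flip: mult.assoc)
      then have "(cmod (p G i))\<^sup>2 \<le> (\<Sum>j\<in>G - {i}. ?r j * (?r j * cmod (x j)))\<^sup>2"
        by (intro power_mono) auto
      also have "\<dots> \<le> (\<Sum>j\<in>G - {i}. (?r j)\<^sup>2) * (\<Sum>j\<in>G - {i}. (?r j * cmod (x j))\<^sup>2)"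
        by (rule Cauchy_Schwarz_ineq_sum)
      also have "\<dots> = (\<Sum>j\<in>G - {i}. cmod (B i j)) * (\<Sum>j\<in>G - {i}. cmod (B i j) * (cmod (x j))\<^sup>2)"
        by (simp add: power_mult_distrib)
      also have "\<dots> \<le> (q * cmod (B i i)) * (\<Sum>j\<in>G - {i}. cmod (B i j) * (cmod (x j))\<^sup>2)"
        using G i by (intro mult_right_mono row_sum sum_nonneg) auto
      finally show ?thesis
        using diag_pos[OF i] by (simp add: field_simps)
    qed
    have "(\<Sum>i\<in>F. (cmod (p G i))\<^sup>2 / cmod (B i i))
        \<le> (\<Sum>i\<in>F. q * (\<Sum>j\<in>G - {i}. cmod (B i j) * (cmod (x j))\<^sup>2))"
      using row F by (intro sum_mono) auto
    also have "\<dots> = q * (\<Sum>i\<in>F. \<Sum>j\<in>G. if j \<noteq> i then cmod (B i j) * (cmod (x j))\<^sup>2 else 0)"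
      unfolding sum_distrib_left[symmetric]
      by (intro arg_cong[where f="(*) q"] sum.cong refl sum.mono_neutral_cong_left) (use G in auto)
    also have "\<dots> = q * (\<Sum>j\<in>G. \<Sum>i\<in>F. if j \<noteq> i then cmod (B i j) * (cmod (x j))\<^sup>2 else 0)"
      by (subst sum.swap) simp
    also have "\<dots> = q * (\<Sum>j\<in>G. (\<Sum>i\<in>F - {j}. cmod (B i j)) * (cmod (x j))\<^sup>2)"
      unfolding sum_distrib_right
      by (intro arg_cong[where f="(*) q"] sum.cong refl sum.mono_neutral_cong_right) (use F in auto)
    also have "\<dots> \<le> q * (\<Sum>j\<in>G. (q * cmod (B j j)) * (cmod (x j))\<^sup>2)"
      using G F q_nonneg by (intro mult_left_mono sum_mono mult_right_mono col_sum) auto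
    also have "\<dots> = q\<^sup>2 * (\<Sum>j\<in>G. cmod (B j j) * (cmod (x j))\<^sup>2)"
      by (simp add: sum_distrib_left power2_eq_square mult_ac)
    also have "\<dots> \<le> q\<^sup>2 * b\<^sup>2"
      using x G by (intro mult_left_mono) (auto simp: weighted_le_def)
    finally show ?thesis by (simp add: power_mult_distrib)
  qed
  have p_lim: "((\<lambda>G. p G i) \<longlongrightarrow> (\<Sum>\<^sub>\<infinity>j\<in>I - {i}. B i j * x j)) (finite_subsets_at_top I)"
    if i: "i \<in> I" for i
  proof -
    have "((\<lambda>j. if j = i then 0 else B i j * x j) has_sum (\<Sum>\<^sub>\<infinity>j\<in>I - {i}. B i j * x j)) I"
      using has_sum_infsum[OF off_diag_summable[OF i weighted_le_sup[OF x b]]]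
      by (rule has_sum_cong_neutral[THEN iffD1, rotated -1]) auto
    then have "((\<lambda>G. \<Sum>j\<in>G. if j = i then 0 else B i j * x j)
        \<longlongrightarrow> (\<Sum>\<^sub>\<infinity>j\<in>I - {i}. B i j * x j)) (finite_subsets_at_top I)"
      by (simp add: has_sum_def)
    moreover have "\<forall>\<^sub>F G in finite_subsets_at_top I.
        (\<Sum>j\<in>G. if j = i then 0 else B i j * x j) = p G i"
      by (rule eventually_finite_subsets_at_top_weakI)
        (auto simp: p_def intro!: sum.mono_neutral_cong_right split: if_splits)
    ultimately show ?thesis
      by (rule Lim_transform_eventually)
  qed
  have "((\<lambda>G. \<Sum>i\<in>F. (cmod (p G i))\<^sup>2 / cmod (B i i)) \<longlongrightarrow>
      (\<Sum>i\<in>F. (cmod (\<Sum>\<^sub>\<infinity>j\<in>I - {i}. B i j * x j))\<^sup>2 / cmod (B i i))) (finite_subsets_at_top I)"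
    using F by (intro tendsto_intros p_lim) (auto dest: diag_nz)
  moreover have "\<forall>\<^sub>F G in finite_subsets_at_top I.
      (\<Sum>i\<in>F. (cmod (p G i))\<^sup>2 / cmod (B i i)) \<le> (q * b)\<^sup>2"
    by (rule eventually_finite_subsets_at_top_weakI) (use finite_section in blast)
  ultimately have "(\<Sum>i\<in>F. (cmod (\<Sum>\<^sub>\<infinity>j\<in>I - {i}. B i j * x j))\<^sup>2 / cmod (B i i)) \<le> (q * b)\<^sup>2"
    by (rule tendsto_upperbound) simp
  moreover have "(\<Sum>i\<in>F. cmod (B i i) * (cmod (jacobi x i))\<^sup>2)
      = (\<Sum>i\<in>F. (cmod (\<Sum>\<^sub>\<infinity>j\<in>I - {i}. B i j * x j))\<^sup>2 / cmod (B i i))"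
    using F(2) by (intro sum.cong refl)
      (auto simp: jacobi_def norm_divide power_divide power2_eq_square dest: diag_nz)
  ultimately show "(\<Sum>i\<in>F. cmod (B i i) * (cmod (jacobi x i))\<^sup>2) \<le> (q * b)\<^sup>2" by simp
qed

lemma weighted_le_diff:
  assumes "weighted_le x a" "weighted_le y b" "0 \<le> a" "0 \<le> b"
  shows "weighted_le (\<lambda>i. x i - y i) (a + b)"
  unfolding weighted_le_def
proof safe
  fix F assume F: "finite F" "F \<subseteq> I"
  let ?w = "\<lambda>z i. sqrt (cmod (B i i)) * cmod (z i)"
  have w: "L2_set (?w z) F = sqrt (\<Sum>i\<in>F. cmod (B i i) * (cmod (z i))\<^sup>2)" for z
    by (simp add: L2_set_def power_mult_distrib)
  have "L2_set (?w (\<lambda>i. x i - y i)) F \<le> L2_set (\<lambda>i. ?w x i + ?w y i) F"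
    unfolding distrib_left[symmetric] by (intro L2_set_mono mult_left_mono norm_triangle_ineq4) auto
  also have "\<dots> \<le> L2_set (?w x) F + L2_set (?w y) F"
    by (rule L2_set_triangle_ineq)
  also have "\<dots> \<le> a + b"
    using assms F unfolding w by (intro add_mono real_le_lsqrt sum_nonneg) (auto simp: weighted_le_def)
  finally show "(\<Sum>i\<in>F. cmod (B i i) * (cmod (x i - y i))\<^sup>2) \<le> (a + b)\<^sup>2"
    unfolding w by (simp add: sqrt_le_D)
qed

text \<open>A bounded solution of \<open>B x = 0\<close> satisfies \<open>x = - jacobi x\<close>, so each bound \<open>c\<close> on it improves to
  \<open>q c\<close>.\<close>

lemma matrix_apply_inj:
  assumes i: "i \<in> I" and c: "\<And>j. j \<in> I \<Longrightarrow> cmod (x j) \<le> c"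
    and zero: "\<And>j. j \<in> I \<Longrightarrow> matrix_apply I B x j = 0"
  shows "x i = 0"
proof -
  have fixpoint: "x j = - jacobi x j" if "j \<in> I" for j
    using zero[OF that] diag_nz[OF that] matrix_apply_eq[OF that c] by (simp add: eq_neg_iff_add_eq_0)
  have bound: "\<forall>j\<in>I. cmod (x j) \<le> q ^ n * c" for n
  proof (induction n)
    case (Suc n)
    then show ?case
      using jacobi_sup_le[where x=x and c="q ^ n * c"] fixpoint by (metis mult.assoc norm_minus_cancel power_Suc)
  qed (use c in simp)
  have "(\<lambda>n. q ^ n * c) \<longlonglongrightarrow> 0"
    using q_nonneg q_less_1 by (intro tendsto_mult_left_zero LIMSEQ_realpow_zero)
  then have "cmod (x i) \<le> 0"
    by (rule tendsto_lowerbound) (use bound i in auto)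
  then show ?thesis by simp
qed

text \<open>Jacobi iteration.  The bound is that of the geometric series: starting from
  \<open>\<parallel>D\<^sup>-\<^sup>1 y\<parallel> \<le> p / \<surd>\<delta>\<close> in the weighted norm, the ball of radius \<open>p / (\<surd>\<delta> (1 - q))\<close> is invariant.\<close>

lemma solve:
  assumes p: "0 \<le> p" and y: "\<And>F. finite F \<Longrightarrow> F \<subseteq> I \<Longrightarrow> (\<Sum>i\<in>F. (cmod (y i))\<^sup>2) \<le> p\<^sup>2"
  obtains x where "weighted_le x (p / (sqrt \<delta> * (1 - q)))"
    and "\<And>i. i \<in> I \<Longrightarrow> matrix_apply I B x i = y i"
proof -
  define z where "z i = y i / B i i" for i
  define b where "b = p / (sqrt \<delta> * (1 - q))"
  define c where "c = b / sqrt \<delta>"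
  have b0: "0 \<le> b" and c0: "0 \<le> c"
    using p delta_pos q_less_1 by (simp_all add: b_def c_def)
  have z: "weighted_le z (p / sqrt \<delta>)"
    unfolding weighted_le_def
  proof safe
    fix F assume F: "finite F" "F \<subseteq> I"
    have "cmod (B i i) * (cmod (z i))\<^sup>2 \<le> (cmod (y i))\<^sup>2 / \<delta>" if "i \<in> I" for i
    proof -
      have "cmod (B i i) * (cmod (z i))\<^sup>2 = (cmod (y i))\<^sup>2 / cmod (B i i)"
        using diag_nz[OF that] by (simp add: z_def norm_divide power_divide power2_eq_square)
      also have "\<dots> \<le> (cmod (y i))\<^sup>2 / \<delta>"
        using diag_ge[OF that] diag_pos[OF that] delta_pos by (intro divide_left_mono) auto
      finally show ?thesis .
    qed
    then have "(\<Sum>i\<in>F. cmod (B i i) * (cmod (z i))\<^sup>2) \<le> (\<Sum>i\<in>F. (cmod (y i))\<^sup>2 / \<delta>)"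
      using F by (intro sum_mono) auto
    also have "\<dots> \<le> p\<^sup>2 / \<delta>"
      unfolding sum_divide_distrib[symmetric] using y[OF F] delta_pos by (intro divide_right_mono) auto
    finally show "(\<Sum>i\<in>F. cmod (B i i) * (cmod (z i))\<^sup>2) \<le> (p / sqrt \<delta>)\<^sup>2"
      using delta_pos by (simp add: power_divide)
  qed
  \<comment> \<open>starting at zero makes the iterates lie in the invariant ball from the beginning\<close>
  define X where "X n = ((\<lambda>x i. z i - jacobi x i) ^^ n) (\<lambda>_. 0)" for n
  have X_Suc: "X (Suc n) i = z i - jacobi (X n) i" for n i
    by (simp add: X_def)
  have X_weighted: "weighted_le (X n) b" for n
  proof (induction n)
    case (Suc n)
    have "weighted_le (\<lambda>i. z i - jacobi (X n) i) (p / sqrt \<delta> + q * b)"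
      using p delta_pos q_nonneg b0 by (intro weighted_le_diff z jacobi_weighted_le Suc) auto
    moreover have "p / sqrt \<delta> + q * b = b"
      using delta_pos q_less_1 by (simp add: b_def field_simps)
    ultimately show ?case by (simp add: X_def)
  qed (simp add: X_def weighted_le_def)
  have X_sup: "cmod (X n i) \<le> c" if "i \<in> I" for n i
    using weighted_le_sup[OF X_weighted b0 that] by (simp add: c_def)
  have X_incr: "\<forall>i\<in>I. cmod (X (Suc n) i - X n i) \<le> q ^ n * (2 * c)" for n
  proof (induction n)
    case 0
    show ?case
    proof
      fix i assume "i \<in> I"
      then show "cmod (X (Suc 0) i - X 0 i) \<le> q ^ 0 * (2 * c)"
        using norm_triangle_ineq4[of "X (Suc 0) i" "X 0 i"] X_sup[of i 0] X_sup[of i "Suc 0"] by simp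
    qed
  next
    case (Suc n)
    show ?case
    proof
      fix i assume i: "i \<in> I"
      have "X (Suc (Suc n)) i - X (Suc n) i = - (jacobi (X (Suc n)) i - jacobi (X n) i)"
        by (subst (1 2) X_Suc) simp
      also have "\<dots> = - jacobi (\<lambda>j. X (Suc n) j - X n j) i"
        using jacobi_diff[OF i X_sup X_sup] by simp
      finally show "cmod (X (Suc (Suc n)) i - X (Suc n) i) \<le> q ^ Suc n * (2 * c)"
        using jacobi_sup_le[OF i, of "\<lambda>j. X (Suc n) j - X n j" "q ^ n * (2 * c)"] Suc
        by (simp add: mult.assoc)
    qed
  qed
  have uc: "uniformly_convergent_on I (\<lambda>n i. X n i)"
  proof -
    have "uniformly_convergent_on I (\<lambda>n i. \<Sum>k<n. X (Suc k) i - X k i)"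
    proof (rule Weierstrass_m_test'_ev)
      show "\<forall>\<^sub>F n in sequentially. \<forall>i\<in>I. norm (X (Suc n) i - X n i) \<le> q ^ n * (2 * c)"
        using X_incr by simp
      show "summable (\<lambda>n. q ^ n * (2 * c))"
        using q_nonneg q_less_1 by (intro summable_mult2 summable_geometric) simp
    qed
    then show ?thesis
      by (subst (asm) sum_lessThan_telescope) (simp add: X_def)
  qed
  then obtain x where x: "uniform_limit I (\<lambda>n i. X n i) x sequentially"
    unfolding uniformly_convergent_on_def by blast
  have lim: "(\<lambda>n. X n i) \<longlonglongrightarrow> x i" if "i \<in> I" for i
    using tendsto_uniform_limitI[OF x that] .
  have x_weighted: "weighted_le x b"
    using X_weighted lim by (rule weighted_le_lim)
  have x_sup: "cmod (x i) \<le> c" if "i \<in> I" for i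
    using weighted_le_sup[OF x_weighted b0 that] by (simp add: c_def)
  have "matrix_apply I B x i = y i" if i: "i \<in> I" for i
  proof -
    have "(\<lambda>n. jacobi (X n) i) \<longlonglongrightarrow> jacobi x i"
    proof (rule tendstoI)
      fix e :: real assume "0 < e"
      from uniform_limitD[OF x this]
      show "\<forall>\<^sub>F n in sequentially. dist (jacobi (X n) i) (jacobi x i) < e"
      proof (rule eventually_mono)
        fix n assume n: "\<forall>j\<in>I. dist (X n j) (x j) < e"
        have "cmod (jacobi (\<lambda>j. X n j - x j) i) \<le> q * e"
          by (rule jacobi_sup_le[OF i]) (use n in \<open>auto simp: dist_norm less_imp_le\<close>)
        moreover have "q * e < e"
          using q_less_1 \<open>0 < e\<close> by simp
        ultimately show "dist (jacobi (X n) i) (jacobi x i) < e"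
          using jacobi_diff[OF i X_sup x_sup] by (simp add: dist_norm)
      qed
    qed
    then have "(\<lambda>n. X (Suc n) i) \<longlonglongrightarrow> z i - jacobi x i"
      unfolding X_Suc by (intro tendsto_intros)
    then have "x i = z i - jacobi x i"
      using LIMSEQ_Suc[OF lim[OF i]] LIMSEQ_unique by blast
    then show ?thesis
      using matrix_apply_eq[OF i x_sup] diag_nz[OF i] by (simp add: z_def)
  qed
  then show ?thesis
    using that x_weighted by (simp add: b_def)
qed

end

section \<open>The Fourier transform of a Riesz basis\<close>

lemma le_if_le_add_mult_eps:
  fixes x y k :: real
  assumes "\<And>e. 0 < e \<Longrightarrow> x \<le> y + k * e"
  shows "x \<le> y"
proof -
  have "((\<lambda>e. y + k * e) \<longlongrightarrow> y + k * 0) (at_right 0)"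
    by (intro tendsto_intros)
  moreover have "\<forall>\<^sub>F e in at_right 0. x \<le> y + k * e"
    using assms eventually_at_right_less by (rule eventually_mono[rotated])
  ultimately show ?thesis
    using tendsto_lowerbound[of "\<lambda>e. y + k * e" _ "at_right 0" x] by auto
qed

lemma summable_on_tail_small:
  fixes f :: "'i \<Rightarrow> real"
  assumes "f summable_on A" "0 < e"
  obtains F where "finite F" "F \<subseteq> A" "\<And>G. finite G \<Longrightarrow> G \<subseteq> A - F \<Longrightarrow> sum f G < e"
proof -
  obtain s where "(sum f \<longlongrightarrow> s) (finite_subsets_at_top A)"
    using assms(1) by (auto simp: summable_on_def has_sum_def)
  then have "\<forall>\<^sub>F F in finite_subsets_at_top A. dist (sum f F) s < e / 2"
    by (rule tendstoD) (use assms(2) in simp)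
  then obtain F where F: "finite F" "F \<subseteq> A"
    and dist: "\<And>G. finite G \<Longrightarrow> F \<subseteq> G \<Longrightarrow> G \<subseteq> A \<Longrightarrow> dist (sum f G) s < e / 2"
    unfolding eventually_finite_subsets_at_top by metis
  have "sum f G < e" if "finite G" "G \<subseteq> A - F" for G
  proof -
    have "sum f (F \<union> G) = sum f F + sum f G"
      using F that by (intro sum.union_disjoint) auto
    then show ?thesis
      using dist[of F] dist[of "F \<union> G"] F that unfolding dist_real_def
      by (smt (verit) Diff_subset Un_least Un_upper1 finite_UnI field_sum_of_halves order_refl subset_trans)
  qed
  then show ?thesis using that F by blast
qed

text \<open>The frame inequalities are assumed for finite combinations only; density extends them to \<open>L\<^sup>2\<close>.\<close>

locale riesz_system =
  fixes M :: "'a measure" and I :: "'i set" and u v :: "'i \<Rightarrow> 'a \<Rightarrow> complex" and c C :: real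
  assumes u_L2: "\<And>i. i \<in> I \<Longrightarrow> u i \<in> L2 M"
    and v_L2: "\<And>i. i \<in> I \<Longrightarrow> v i \<in> L2 M"
    and v_norm: "\<And>i. i \<in> I \<Longrightarrow> L2_norm M (v i) = 1"
    and biorthogonal: "\<And>i j. i \<in> I \<Longrightarrow> j \<in> I \<Longrightarrow> L2_inner M (u i) (v j) = (if i = j then 1 else 0)"
    and dense: "\<And>f e. f \<in> L2 M \<Longrightarrow> 0 < e \<Longrightarrow>
          \<exists>F a. finite F \<and> F \<subseteq> I \<and> L2_norm M (\<lambda>x. f x - (\<Sum>i\<in>F. a i * u i x)) < e"
    and c_pos: "0 < c" and C_pos: "0 < C"
    and lower: "\<And>F a. finite F \<Longrightarrow> F \<subseteq> I \<Longrightarrow>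
          c * (\<Sum>i\<in>F. (cmod (a i))\<^sup>2) \<le> (L2_norm M (\<lambda>x. \<Sum>i\<in>F. a i * u i x))\<^sup>2"
    and upper: "\<And>F a. finite F \<Longrightarrow> F \<subseteq> I \<Longrightarrow>
          (L2_norm M (\<lambda>x. \<Sum>i\<in>F. a i * u i x))\<^sup>2 \<le> C * (\<Sum>i\<in>F. (cmod (a i))\<^sup>2)"
begin

lemma synthesis_L2: "F \<subseteq> I \<Longrightarrow> (\<lambda>x. \<Sum>i\<in>F. a i * u i x) \<in> L2 M"
  by (intro L2_sum L2_scale u_L2) auto

lemma fourier_lincomb:
  assumes "f \<in> L2 M" "g \<in> L2 M" "i \<in> I"
  shows "fourier M v (\<lambda>x. a * f x + b * g x) i = a * fourier M v f i + b * fourier M v g i"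
  using L2_inner_lincomb[OF assms(1,2) v_L2[OF assms(3)]] by (simp add: fourier_def L2_inner_def)

lemma fourier_diff:
  assumes "f \<in> L2 M" "g \<in> L2 M" "i \<in> I"
  shows "fourier M v (\<lambda>x. f x - g x) i = fourier M v f i - fourier M v g i"
  using fourier_lincomb[OF assms, of 1 "-1"] by simp

lemma fourier_le:
  assumes "f \<in> L2 M" "i \<in> I"
  shows "cmod (fourier M v f i) \<le> L2_norm M f"
  using L2_inner_le[OF assms(1) v_L2[OF assms(2)]] v_norm[OF assms(2)]
  by (simp add: fourier_def L2_inner_def)

lemma fourier_synthesis:
  assumes "finite F" "F \<subseteq> I" "j \<in> I"
  shows "fourier M v (\<lambda>x. \<Sum>i\<in>F. a i * u i x) j = (if j \<in> F then a j else 0)"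
  using assms
proof (induction F)
  case (insert i F)
  have "fourier M v (\<lambda>x. a i * u i x + 1 * (\<Sum>i\<in>F. a i * u i x)) j
      = a i * fourier M v (u i) j + 1 * fourier M v (\<lambda>x. \<Sum>i\<in>F. a i * u i x) j"
    using insert by (intro fourier_lincomb u_L2 synthesis_L2) auto
  moreover have "fourier M v (u i) j = (if i = j then 1 else 0)"
    using biorthogonal[of i j] insert by (simp add: fourier_def L2_inner_def)
  ultimately show ?case using insert by auto
qed (simp add: fourier_def)

lemma bessel_synthesis:
  fixes a :: "'i \<Rightarrow> complex"
  assumes F: "finite F" "F \<subseteq> I" and G: "finite G" "G \<subseteq> I"
  defines "g \<equiv> (\<lambda>x. \<Sum>i\<in>G. a i * u i x)"
  shows "sqrt c * L2_set (\<lambda>i. cmod (fourier M v g i)) F \<le> L2_norm M g"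
proof -
  have "(\<Sum>i\<in>F. (cmod (fourier M v g i))\<^sup>2) \<le> (\<Sum>i\<in>F \<union> G. (cmod (fourier M v g i))\<^sup>2)"
    using F G by (intro sum_mono2) auto
  also have "\<dots> = (\<Sum>i\<in>G. (cmod (a i))\<^sup>2)"
  proof (rule sum.mono_neutral_cong_right)
    show "\<forall>i\<in>F \<union> G - G. (cmod (fourier M v g i))\<^sup>2 = 0"
      using F G by (auto simp: g_def fourier_synthesis)
    show "(cmod (fourier M v g i))\<^sup>2 = (cmod (a i))\<^sup>2" if "i \<in> G" for i
      using that G fourier_synthesis[of G i a] by (auto simp: g_def)
  qed (use F G in auto)
  finally have "c * (\<Sum>i\<in>F. (cmod (fourier M v g i))\<^sup>2) \<le> (L2_norm M g)\<^sup>2"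
    using lower[OF G, of a] c_pos unfolding g_def by (meson mult_left_mono less_imp_le order_trans)
  then show ?thesis
    unfolding L2_set_def by (simp add: real_le_lsqrt flip: real_sqrt_mult)
qed

text \<open>Approximate \<open>f\<close> by a finite combination within \<open>e\<close>; each coefficient moves by at most \<open>e\<close>, and only
  the finitely many coefficients in \<open>F\<close> matter, so \<open>e\<close> can be sent to zero.\<close>

lemma bessel:
  assumes f: "f \<in> L2 M" and F: "finite F" "F \<subseteq> I"
  shows "sqrt c * L2_set (\<lambda>i. cmod (fourier M v f i)) F \<le> L2_norm M f"
proof (rule le_if_le_add_mult_eps)
  fix e :: real assume e: "0 < e"
  obtain G a where G: "finite G" "G \<subseteq> I"
    and small: "L2_norm M (\<lambda>x. f x - (\<Sum>i\<in>G. a i * u i x)) < e"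
    using dense[OF f e] by blast
  define g where "g x = (\<Sum>i\<in>G. a i * u i x)" for x
  have g: "g \<in> L2 M" using synthesis_L2[OF G(2)] by (simp add: g_def[abs_def])
  have diff: "cmod (fourier M v f i - fourier M v g i) \<le> e" if "i \<in> I" for i
    using fourier_le[OF L2_diff[OF f g] that] fourier_diff[OF f g that] small
    by (simp add: g_def[abs_def])
  have "L2_set (\<lambda>i. cmod (fourier M v f i)) F
      \<le> L2_set (\<lambda>i. cmod (fourier M v g i) + cmod (fourier M v f i - fourier M v g i)) F"
    by (rule L2_set_mono) (simp_all add: norm_triangle_sub)
  also have "\<dots> \<le> L2_set (\<lambda>i. cmod (fourier M v g i)) F
      + L2_set (\<lambda>i. cmod (fourier M v f i - fourier M v g i)) F"
    by (rule L2_set_triangle_ineq)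
  also have "L2_set (\<lambda>i. cmod (fourier M v f i - fourier M v g i)) F \<le> L2_set (\<lambda>i. e) F"
    using diff F by (intro L2_set_mono) auto
  also have "L2_set (\<lambda>i. e) F = sqrt (card F) * e"
    using e by (simp add: L2_set_def real_sqrt_mult)
  finally have "sqrt c * L2_set (\<lambda>i. cmod (fourier M v f i)) F
      \<le> sqrt c * (L2_set (\<lambda>i. cmod (fourier M v g i)) F + sqrt (card F) * e)"
    using c_pos by (intro mult_left_mono) auto
  also have "\<dots> \<le> L2_norm M g + sqrt c * sqrt (card F) * e"
    using bessel_synthesis[OF F G, of a] by (simp add: g_def[abs_def] distrib_left)
  also have "L2_norm M g \<le> e + L2_norm M f"
    using L2_triangle_le[OF g f] small by (simp add: g_def[abs_def] L2_norm_minus_commute)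
  finally show "sqrt c * L2_set (\<lambda>i. cmod (fourier M v f i)) F
      \<le> L2_norm M f + (1 + sqrt c * sqrt (card F)) * e"
    by (simp add: algebra_simps)
qed

lemma bessel_power2:
  assumes f: "f \<in> L2 M" and F: "finite F" "F \<subseteq> I"
  shows "(\<Sum>i\<in>F. (cmod (fourier M v f i))\<^sup>2) \<le> (L2_norm M f / sqrt c)\<^sup>2"
proof -
  have "L2_set (\<lambda>i. cmod (fourier M v f i)) F \<le> L2_norm M f / sqrt c"
    using bessel[OF assms] c_pos by (simp add: field_simps)
  then show ?thesis unfolding L2_set_def by (rule sqrt_le_D)
qed

lemma fourier_ell2: "f \<in> L2 M \<Longrightarrow> fourier M v f \<in> ell2 I"
  by (rule ell2_I) (rule bessel_power2)

text \<open>The approximating combination \<open>g\<close> now has an uncontrolled number of terms, but Bessel's inequality for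
  \<open>f - g\<close> bounds the change of all coefficients together.\<close>

lemma L2_norm_le_fourier:
  assumes f: "f \<in> L2 M" and b: "0 \<le> b"
    and coeff: "\<And>F. finite F \<Longrightarrow> F \<subseteq> I \<Longrightarrow> (\<Sum>i\<in>F. (cmod (fourier M v f i))\<^sup>2) \<le> b\<^sup>2"
  shows "L2_norm M f \<le> sqrt C * b"
proof (rule le_if_le_add_mult_eps)
  fix e :: real assume e: "0 < e"
  obtain G a where G: "finite G" "G \<subseteq> I"
    and small: "L2_norm M (\<lambda>x. f x - (\<Sum>i\<in>G. a i * u i x)) < e"
    using dense[OF f e] by blast
  define g where "g x = (\<Sum>i\<in>G. a i * u i x)" for x
  have g: "g \<in> L2 M" using synthesis_L2[OF G(2)] by (simp add: g_def[abs_def])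
  have ghat: "fourier M v g i = a i" if "i \<in> G" for i
    using fourier_synthesis[OF G, of i a] that G(2) by (auto simp: g_def[abs_def])
  have "L2_set (\<lambda>i. cmod (a i)) G
      \<le> L2_set (\<lambda>i. cmod (fourier M v f i) + cmod (fourier M v (\<lambda>x. f x - g x) i)) G"
  proof (rule L2_set_mono)
    fix i assume i: "i \<in> G"
    then have "fourier M v (\<lambda>x. f x - g x) i = fourier M v f i - a i"
      using fourier_diff[OF f g] ghat G(2) by auto
    then show "cmod (a i) \<le> cmod (fourier M v f i) + cmod (fourier M v (\<lambda>x. f x - g x) i)"
      using norm_triangle_sub[of "a i" "fourier M v f i"] by (simp add: norm_minus_commute)
  qed simp
  also have "\<dots> \<le> L2_set (\<lambda>i. cmod (fourier M v f i)) G
      + L2_set (\<lambda>i. cmod (fourier M v (\<lambda>x. f x - g x) i)) G"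
    by (rule L2_set_triangle_ineq)
  also have "L2_set (\<lambda>i. cmod (fourier M v f i)) G \<le> b"
    unfolding L2_set_def using coeff[OF G] b by (intro real_le_lsqrt) (auto intro: sum_nonneg)
  also have "L2_set (\<lambda>i. cmod (fourier M v (\<lambda>x. f x - g x) i)) G \<le> e / sqrt c"
    using bessel[OF L2_diff[OF f g] G] small c_pos by (simp add: g_def[abs_def] field_simps)
  finally have a: "L2_set (\<lambda>i. cmod (a i)) G \<le> b + e / sqrt c" by simp
  have "L2_norm M g \<le> sqrt (C * (\<Sum>i\<in>G. (cmod (a i))\<^sup>2))"
    using upper[OF G, of a] by (intro real_le_rsqrt) (simp add: g_def[abs_def])
  also have "\<dots> = sqrt C * L2_set (\<lambda>i. cmod (a i)) G"
    by (simp add: L2_set_def real_sqrt_mult)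
  also have "\<dots> \<le> sqrt C * (b + e / sqrt c)"
    using a C_pos by (intro mult_left_mono) auto
  finally show "L2_norm M f \<le> sqrt C * b + (1 + sqrt C / sqrt c) * e"
    using L2_triangle_le[OF f g] small by (simp add: g_def[abs_def] algebra_simps)
qed

lemma fourier_inj:
  assumes f: "f \<in> L2 M" and g: "g \<in> L2 M" and eq: "\<And>i. i \<in> I \<Longrightarrow> fourier M v f i = fourier M v g i"
  shows "AE x in M. f x = g x"
proof -
  have "L2_norm M (\<lambda>x. f x - g x) \<le> sqrt C * 0"
  proof (rule L2_norm_le_fourier[OF L2_diff[OF f g]])
    fix F assume "F \<subseteq> I"
    then have "(\<Sum>i\<in>F. (cmod (fourier M v (\<lambda>x. f x - g x) i))\<^sup>2) = 0"
      using fourier_diff[OF f g] eq by (intro sum.neutral) auto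
    then show "(\<Sum>i\<in>F. (cmod (fourier M v (\<lambda>x. f x - g x) i))\<^sup>2) \<le> 0\<^sup>2" by simp
  qed simp
  then have "L2_norm M (\<lambda>x. f x - g x) = 0"
    using L2_norm_nonneg[of M "\<lambda>x. f x - g x"] by linarith
  then show ?thesis
    using L2_norm_eq_0_iff[OF L2_diff[OF f g]] by simp
qed

text \<open>The partial sums over index sets with geometrically small tails converge in \<open>L\<^sup>2\<close>.  The index
  sets are made increasing so that each increment is itself a sum of basis elements over the difference.\<close>

lemma fourier_surj:
  assumes "y \<in> ell2 I"
  obtains f where "f \<in> L2 M" "\<And>i. i \<in> I \<Longrightarrow> fourier M v f i = y i"
proof -
  have "\<forall>n. \<exists>F. finite F \<and> F \<subseteq> I \<and>
      (\<forall>G. finite G \<and> G \<subseteq> I - F \<longrightarrow> (\<Sum>i\<in>G. (cmod (y i))\<^sup>2) < ((1/2) ^ n)\<^sup>2)"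
  proof
    fix n :: nat
    have "(\<lambda>i. (cmod (y i))\<^sup>2) summable_on I"
      using assms by (simp add: ell2_def)
    from summable_on_tail_small[OF this, of "((1/2) ^ n)\<^sup>2"]
    obtain F where "finite F" "F \<subseteq> I"
        "\<And>G. finite G \<Longrightarrow> G \<subseteq> I - F \<Longrightarrow> (\<Sum>i\<in>G. (cmod (y i))\<^sup>2) < ((1/2) ^ n)\<^sup>2"
      by auto
    then show "\<exists>F. finite F \<and> F \<subseteq> I \<and>
      (\<forall>G. finite G \<and> G \<subseteq> I - F \<longrightarrow> (\<Sum>i\<in>G. (cmod (y i))\<^sup>2) < ((1/2) ^ n)\<^sup>2)"
      by blast
  qed
  then obtain F where F: "\<And>n. finite (F n)" "\<And>n. F n \<subseteq> I"
    and tail: "\<And>n G. finite G \<Longrightarrow> G \<subseteq> I - F n \<Longrightarrow> (\<Sum>i\<in>G. (cmod (y i))\<^sup>2) < ((1/2) ^ n)\<^sup>2"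
    by metis
  define H where "H n = (\<Union>k\<le>n. F k)" for n
  have H: "finite (H n)" "H n \<subseteq> I" "F n \<subseteq> H n" "H n \<subseteq> H (Suc n)" for n
    using F by (auto simp: H_def intro: le_SucI)
  define g where "g n x = (\<Sum>i\<in>H n. y i * u i x)" for n x
  have g: "g n \<in> L2 M" for n
    using synthesis_L2[OF H(2)] by (simp add: g_def[abs_def])
  have "L2_norm M (\<lambda>x. g (Suc n) x - g n x) \<le> sqrt C * (1/2) ^ n" for n
  proof -
    let ?D = "H (Suc n) - H n"
    have "g (Suc n) x - g n x = (\<Sum>i\<in>?D. y i * u i x)" for x
      unfolding g_def using H by (simp add: sum_diff)
    then have "(L2_norm M (\<lambda>x. g (Suc n) x - g n x))\<^sup>2 \<le> C * (\<Sum>i\<in>?D. (cmod (y i))\<^sup>2)"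
      using upper[of ?D y] H by auto
    also have "\<dots> \<le> C * ((1/2) ^ n)\<^sup>2"
      using tail[of ?D n] H[of n] H[of "Suc n"] C_pos by (intro mult_left_mono less_imp_le[OF tail]) auto
    also have "\<dots> = (sqrt C * (1/2) ^ n)\<^sup>2"
      using C_pos by (simp add: power_mult_distrib)
    finally show ?thesis
      by (rule power2_le_imp_le) (use C_pos in simp)
  qed
  moreover have "summable (\<lambda>n. sqrt C * (1/2::real) ^ n)"
    by (intro summable_mult summable_geometric) simp
  ultimately obtain f where f: "f \<in> L2 M" and conv: "(\<lambda>n. L2_norm M (\<lambda>x. g n x - f x)) \<longlonglongrightarrow> 0"
    using L2_complete[of g M "\<lambda>n. sqrt C * (1/2) ^ n"] g by blast
  have "fourier M v f i = y i" if i: "i \<in> I" for i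
  proof -
    have "(\<lambda>n. fourier M v (g n) i - fourier M v f i) \<longlonglongrightarrow> 0"
    proof (rule Lim_null_comparison[OF always_eventually conv], rule allI)
      show "norm (fourier M v (g n) i - fourier M v f i) \<le> L2_norm M (\<lambda>x. g n x - f x)" for n
        using fourier_le[OF L2_diff[OF g f] i] fourier_diff[OF g f i] by simp
    qed
    then have "(\<lambda>n. fourier M v (g n) i) \<longlonglongrightarrow> fourier M v f i"
      by (simp add: LIM_zero_iff)
    moreover have "(\<lambda>n. fourier M v (g n) i - y i) \<longlonglongrightarrow> 0"
    proof (rule Lim_null_comparison[OF always_eventually], rule allI)
      show "norm (fourier M v (g n) i - y i) \<le> (1/2) ^ n" for n
      proof (cases "i \<in> H n")
        case True
        then show ?thesis using fourier_synthesis[OF H(1)[of n] H(2)[of n] i, of y] by (simp add: g_def[abs_def])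
      next
        case False
        then have "i \<notin> F n" using H by blast
        then have "(cmod (y i))\<^sup>2 < ((1/2) ^ n)\<^sup>2"
          using tail[of "{i}" n] i by simp
        then have "cmod (y i) < (1/2) ^ n"
          by (rule power2_less_imp_less) simp
        then show ?thesis
          using False fourier_synthesis[OF H(1)[of n] H(2)[of n] i, of y] by (simp add: g_def[abs_def])
      qed
      show "(\<lambda>n. (1/2::real) ^ n) \<longlonglongrightarrow> 0" by (rule LIMSEQ_realpow_zero) auto
    qed
    then have "(\<lambda>n. fourier M v (g n) i) \<longlonglongrightarrow> y i"
      by (simp add: LIM_zero_iff)
    ultimately show ?thesis by (rule LIMSEQ_unique)
  qed
  then show ?thesis using that f by blast
qed

lemma inv_fourier_props:
  assumes "y \<in> ell2 I"
  shows "inv_fourier M I v y \<in> L2 M"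
    and "i \<in> I \<Longrightarrow> fourier M v (inv_fourier M I v y) i = y i"
proof -
  have "\<exists>f. f \<in> L2 M \<and> (\<forall>i\<in>I. fourier M v f i = y i)"
    using fourier_surj[OF assms] by metis
  from someI_ex[OF this]
  show "inv_fourier M I v y \<in> L2 M" "i \<in> I \<Longrightarrow> fourier M v (inv_fourier M I v y) i = y i"
    by (auto simp: inv_fourier_def)
qed

end

section \<open>Operators given by a diagonally dominant matrix\<close>

locale dominant_operator = riesz_system M I u v c C + diag_dominant I B \<delta> q
  for M :: "'a measure" and I :: "'i set" and u v :: "'i \<Rightarrow> 'a \<Rightarrow> complex" and c C
    and B :: "'i \<Rightarrow> 'i \<Rightarrow> complex" and \<delta> q
begin

definition op :: "('a \<Rightarrow> complex) \<Rightarrow> 'a \<Rightarrow> complex" where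
  "op f = inv_fourier M I v (matrix_apply I B (fourier M v f))"

definition dom :: "('a \<Rightarrow> complex) set" where
  "dom = {f \<in> L2 M. fourier M v f \<in> matrix_domain I B}"

text \<open>The \<open>L\<^sup>2\<close> norm of \<open>op f\<close> is at least this constant times the weighted norm of the
  coefficients of \<open>f\<close>: \<open>\<surd>c\<close> comes from Bessel's inequality, the other factors from the solution of the matrix equation.\<close>

definition coercivity :: real where "coercivity = sqrt c * (sqrt \<delta> * (1 - q))"

text \<open>The weighted bound is part of the choice, as it is what makes the inverse compact; by uniqueness it
  does not affect which class of functions is selected.\<close>

definition op_inv :: "('a \<Rightarrow> complex) \<Rightarrow> 'a \<Rightarrow> complex" where
  "op_inv g = (SOME f. f \<in> L2 M \<and> weighted_le (fourier M v f) (L2_norm M g / coercivity) \<and>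
     (\<forall>i\<in>I. matrix_apply I B (fourier M v f) i = fourier M v g i))"

lemma coercivity_pos: "0 < coercivity"
  using c_pos delta_pos q_less_1 by (simp add: coercivity_def)

text \<open>Square summable sequences are bounded and the rows of \<open>B\<close> are absolutely summable, so the series
  defining the matrix product always converge.\<close>

lemma dom_iff: "f \<in> dom \<longleftrightarrow> f \<in> L2 M \<and> matrix_apply I B (fourier M v f) \<in> ell2 I"
  using full_row_summable[OF _ fourier_le] fourier_ell2 by (auto simp: dom_def matrix_domain_def)

lemma op:
  assumes "f \<in> dom"
  shows "op f \<in> L2 M" and "i \<in> I \<Longrightarrow> fourier M v (op f) i = matrix_apply I B (fourier M v f) i"
  using inv_fourier_props assms by (auto simp: op_def dom_iff)

lemma op_inv:
  assumes g: "g \<in> L2 M"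
  shows "op_inv g \<in> L2 M" and "weighted_le (fourier M v (op_inv g)) (L2_norm M g / coercivity)"
    and "i \<in> I \<Longrightarrow> matrix_apply I B (fourier M v (op_inv g)) i = fourier M v g i"
proof -
  obtain x where x: "weighted_le x (L2_norm M g / sqrt c / (sqrt \<delta> * (1 - q)))"
    and eq: "\<And>i. i \<in> I \<Longrightarrow> matrix_apply I B x i = fourier M v g i"
    by (rule solve[of "L2_norm M g / sqrt c" "fourier M v g"]) (use bessel_power2[OF g] c_pos in auto)
  obtain f where f: "f \<in> L2 M" and fx: "\<And>i. i \<in> I \<Longrightarrow> fourier M v f i = x i"
    using fourier_surj[OF weighted_le_ell2[OF x]] by blast
  have "\<exists>f. f \<in> L2 M \<and> weighted_le (fourier M v f) (L2_norm M g / coercivity) \<and>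
     (\<forall>i\<in>I. matrix_apply I B (fourier M v f) i = fourier M v g i)"
  proof (intro exI[of _ f] conjI ballI)
    show "weighted_le (fourier M v f) (L2_norm M g / coercivity)"
      using x weighted_le_cong[of "fourier M v f" x] fx by (simp add: coercivity_def)
    show "matrix_apply I B (fourier M v f) i = fourier M v g i" if "i \<in> I" for i
      using matrix_apply_cong[of I "fourier M v f" x B i] fx eq[OF that] by simp
  qed (rule f)
  from someI_ex[OF this]
  show "op_inv g \<in> L2 M" "weighted_le (fourier M v (op_inv g)) (L2_norm M g / coercivity)"
    "i \<in> I \<Longrightarrow> matrix_apply I B (fourier M v (op_inv g)) i = fourier M v g i"
    by (auto simp: op_inv_def)
qed

lemma matrix_fourier_lincomb:
  assumes "f \<in> L2 M" "g \<in> L2 M" "i \<in> I"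
  shows "matrix_apply I B (fourier M v (\<lambda>x. a * f x + b * g x)) i
    = a * matrix_apply I B (fourier M v f) i + b * matrix_apply I B (fourier M v g) i"
proof -
  have "matrix_apply I B (fourier M v (\<lambda>x. a * f x + b * g x)) i
      = matrix_apply I B (\<lambda>i. a * fourier M v f i + b * fourier M v g i) i"
    by (rule matrix_apply_cong) (rule fourier_lincomb[OF assms(1,2)])
  also have "\<dots> = a * matrix_apply I B (fourier M v f) i + b * matrix_apply I B (fourier M v g) i"
    by (rule matrix_apply_lincomb[OF assms(3) fourier_le fourier_le]) (use assms in auto)
  finally show ?thesis .
qed

lemma matrix_fourier_inj:
  assumes f: "f \<in> L2 M" and g: "g \<in> L2 M"
    and eq: "\<And>i. i \<in> I \<Longrightarrow> matrix_apply I B (fourier M v f) i = matrix_apply I B (fourier M v g) i"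
  shows "AE x in M. f x = g x"
proof (rule fourier_inj[OF f g])
  fix i assume i: "i \<in> I"
  have "fourier M v (\<lambda>x. 1 * f x + (-1) * g x) i = 0"
  proof (rule matrix_apply_inj[OF i])
    show "cmod (fourier M v (\<lambda>x. 1 * f x + (-1) * g x) j) \<le> L2_norm M (\<lambda>x. 1 * f x + (-1) * g x)"
      if "j \<in> I" for j
      using f g that by (intro fourier_le L2_lincomb)
    show "matrix_apply I B (fourier M v (\<lambda>x. 1 * f x + (-1) * g x)) j = 0" if "j \<in> I" for j
      using matrix_fourier_lincomb[OF f g that, of 1 "-1"] eq[OF that] by simp
  qed
  then show "fourier M v f i = fourier M v g i"
    using fourier_lincomb[OF f g i, of 1 "-1"] by simp
qed

lemma op_linear: "L2_linear_op M dom op"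
  unfolding L2_linear_op_def
proof (intro conjI ballI allI)
  show "dom \<subseteq> L2 M" by (auto simp: dom_iff)
  show "(\<lambda>x. 0) \<in> dom"
    by (simp add: dom_iff matrix_apply_def[abs_def] fourier_def ell2_def)
  show "op f \<in> L2 M" if "f \<in> dom" for f
    using op(1)[OF that] .
  fix f g a b assume f: "f \<in> dom" and g: "g \<in> dom"
  let ?h = "\<lambda>x. a * f x + b * g x"
  have fL2: "f \<in> L2 M" and gL2: "g \<in> L2 M" using f g by (auto simp: dom_iff)
  have h: "?h \<in> dom"
    unfolding dom_iff
  proof
    show "?h \<in> L2 M" using fL2 gL2 by (rule L2_lincomb)
    show "matrix_apply I B (fourier M v ?h) \<in> ell2 I"
      using ell2_cong[of I, OF matrix_fourier_lincomb[OF fL2 gL2]] f g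
      by (simp add: dom_iff ell2_lincomb)
  qed
  show "?h \<in> dom" by (rule h)
  show "AE x in M. op ?h x = a * op f x + b * op g x"
  proof (rule fourier_inj[OF op(1)[OF h] L2_lincomb[OF op(1)[OF f] op(1)[OF g]]])
    show "fourier M v (op ?h) i = fourier M v (\<lambda>x. a * op f x + b * op g x) i" if "i \<in> I" for i
      using op(2)[OF h that] op(2)[OF f that] op(2)[OF g that] matrix_fourier_lincomb[OF fL2 gL2 that]
        fourier_lincomb[OF op(1)[OF f] op(1)[OF g] that] by simp
  qed
qed

lemma op_inv_dom: "g \<in> L2 M \<Longrightarrow> op_inv g \<in> dom"
  using op_inv ell2_cong[of I "matrix_apply I B (fourier M v (op_inv g))" "fourier M v g"] fourier_ell2
  by (simp add: dom_iff)

lemma op_inverse: "L2_inverse_op M dom op op_inv"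
  unfolding L2_inverse_op_def
proof (intro conjI ballI)
  fix g assume g: "g \<in> L2 M"
  show d: "op_inv g \<in> dom" using op_inv_dom[OF g] .
  show "AE x in M. op (op_inv g) x = g x"
    by (rule fourier_inj[OF op(1)[OF d] g]) (simp add: op(2)[OF d] op_inv(3)[OF g])
next
  fix f assume f: "f \<in> dom"
  show "AE x in M. op_inv (op f) x = f x"
  proof (rule matrix_fourier_inj)
    show "f \<in> L2 M" using f by (simp add: dom_iff)
  qed (simp_all add: op_inv op[OF f])
qed

lemma op_inv_bounded: "L2_bounded_op M op_inv"
  unfolding L2_bounded_op_def
proof
  show "L2_linear_op M (L2 M) op_inv"
    unfolding L2_linear_op_def
  proof (intro conjI ballI allI)
    fix f g a b assume f: "f \<in> L2 M" and g: "g \<in> L2 M"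
    show h: "(\<lambda>x. a * f x + b * g x) \<in> L2 M" using f g by (rule L2_lincomb)
    show "AE x in M. op_inv (\<lambda>x. a * f x + b * g x) x = a * op_inv f x + b * op_inv g x"
    proof (rule matrix_fourier_inj)
      show "op_inv (\<lambda>x. a * f x + b * g x) \<in> L2 M" using op_inv(1)[OF h] .
      show "(\<lambda>x. a * op_inv f x + b * op_inv g x) \<in> L2 M"
        using f g by (intro L2_lincomb op_inv)
      show "matrix_apply I B (fourier M v (op_inv (\<lambda>x. a * f x + b * g x))) i
          = matrix_apply I B (fourier M v (\<lambda>x. a * op_inv f x + b * op_inv g x)) i" if "i \<in> I" for i
        using op_inv(3)[OF h that] op_inv(3)[OF f that] op_inv(3)[OF g that] fourier_lincomb[OF f g that]
          matrix_fourier_lincomb[OF op_inv(1)[OF f] op_inv(1)[OF g] that] by simp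
    qed
  qed (auto intro: op_inv)
  show "\<exists>C. \<forall>f\<in>L2 M. L2_norm M (op_inv f) \<le> C * L2_norm M f"
  proof (intro exI ballI)
    fix f assume f: "f \<in> L2 M"
    have "L2_norm M (op_inv f) \<le> sqrt C * (L2_norm M f / coercivity / sqrt \<delta>)"
    proof (rule L2_norm_le_fourier[OF op_inv(1)[OF f]])
      show "0 \<le> L2_norm M f / coercivity / sqrt \<delta>" using coercivity_pos delta_pos by simp
      fix F assume F: "finite F" "F \<subseteq> I"
      have "(\<Sum>i\<in>F. (cmod (fourier M v (op_inv f) i))\<^sup>2) \<le> (L2_norm M f / coercivity)\<^sup>2 / \<delta>"
        by (rule weighted_le_sum[OF op_inv(2)[OF f] F delta_pos]) (use F diag_ge in auto)
      then show "(\<Sum>i\<in>F. (cmod (fourier M v (op_inv f) i))\<^sup>2) \<le> (L2_norm M f / coercivity / sqrt \<delta>)\<^sup>2"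
        using delta_pos by (simp add: power_divide power_mult_distrib)
    qed
    then show "L2_norm M (op_inv f) \<le> (sqrt C / coercivity / sqrt \<delta>) * L2_norm M f" by simp
  qed
qed

text \<open>The images of a bounded sequence have coefficients in a weighted ball.  A subsequence converges in every
  coordinate to a limit in the same ball, and where \<open>\<bar>B i i\<bar> \<ge> k\<close> the square sum of the differences is at
  most \<open>(2b)\<^sup>2 / k\<close>; the remaining coordinates are finite in number.\<close>

lemma op_inv_compact:
  assumes I: "countable I" and diag: "\<And>k. finite {i \<in> I. cmod (B i i) < k}"
  shows "L2_compact_op M op_inv"
  unfolding L2_compact_op_def
proof (intro conjI allI impI op_inv_bounded)
  fix f :: "nat \<Rightarrow> 'a \<Rightarrow> complex"
  assume "(\<forall>n. f n \<in> L2 M) \<and> bounded (range (\<lambda>n. L2_norm M (f n)))"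
  then obtain R where f: "\<And>n. f n \<in> L2 M" and R: "\<And>n. L2_norm M (f n) \<le> R"
    by (auto simp: bounded_iff)
  define b where "b = R / coercivity"
  define X where "X n = fourier M v (op_inv (f n))" for n
  have b0: "0 \<le> b"
    using order_trans[OF L2_norm_nonneg R] coercivity_pos by (simp add: b_def)
  have X: "weighted_le (X n) b" for n
    unfolding X_def b_def
    by (rule weighted_le_mono[OF op_inv(2)[OF f]]) (use R coercivity_pos in \<open>auto intro: divide_right_mono\<close>)
  obtain r where r: "strict_mono r" and conv: "\<And>i. i \<in> I \<Longrightarrow> \<exists>l. (\<lambda>n. X (r n) i) \<longlonglongrightarrow> l"
    using function_convergent_subsequence[OF I, of X "b / sqrt \<delta>"] weighted_le_sup[OF X b0] by blast
  then obtain x where x: "\<And>i. i \<in> I \<Longrightarrow> (\<lambda>n. X (r n) i) \<longlonglongrightarrow> x i"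
    by metis
  have xw: "weighted_le x b"
    using X x by (rule weighted_le_lim)
  obtain g where g: "g \<in> L2 M" and gx: "\<And>i. i \<in> I \<Longrightarrow> fourier M v g i = x i"
    using fourier_surj[OF weighted_le_ell2[OF xw]] by blast
  have "(\<lambda>n. L2_norm M (\<lambda>y. op_inv (f (r n)) y - g y)) \<longlonglongrightarrow> 0"
  proof (rule tendstoI)
    fix e' :: real assume "0 < e'"
    define e where "e = e' / (2 * sqrt C)"
    have e: "0 < e" "sqrt C * e < e'" using \<open>0 < e'\<close> C_pos by (simp_all add: e_def)
    \<comment> \<open>coordinates whose diagonal entry has modulus at least \<open>k\<close> contribute at most \<open>e\<^sup>2 / 2\<close>\<close>
    define k where "k = 8 * b\<^sup>2 / e\<^sup>2 + 1"
    have k: "0 < k" by (simp add: k_def add_nonneg_pos)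
    have kb: "(b + b)\<^sup>2 / k \<le> e\<^sup>2 / 2"
      using e k by (simp add: k_def field_simps power2_eq_square)
    define H where "H = {i \<in> I. cmod (B i i) < k}"
    have H: "finite H" "H \<subseteq> I" using diag by (auto simp: H_def)
    have "(\<lambda>n. \<Sum>i\<in>H. (cmod (X (r n) i - x i))\<^sup>2) \<longlonglongrightarrow> (\<Sum>i\<in>H. (cmod (x i - x i))\<^sup>2)"
      using H by (intro tendsto_intros x) auto
    then have "\<forall>\<^sub>F n in sequentially. (\<Sum>i\<in>H. (cmod (X (r n) i - x i))\<^sup>2) < e\<^sup>2 / 2"
      by (rule order_tendstoD) (use e in simp)
    then show "\<forall>\<^sub>F n in sequentially. dist (L2_norm M (\<lambda>y. op_inv (f (r n)) y - g y)) 0 < e'"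
    proof (rule eventually_mono)
      fix n assume n: "(\<Sum>i\<in>H. (cmod (X (r n) i - x i))\<^sup>2) < e\<^sup>2 / 2"
      have "L2_norm M (\<lambda>y. op_inv (f (r n)) y - g y) \<le> sqrt C * e"
      proof (rule L2_norm_le_fourier[OF L2_diff[OF op_inv(1)[OF f] g]])
        fix F assume F: "finite F" "F \<subseteq> I"
        have "(\<Sum>i\<in>F. (cmod (fourier M v (\<lambda>y. op_inv (f (r n)) y - g y) i))\<^sup>2)
            = (\<Sum>i\<in>F. (cmod (X (r n) i - x i))\<^sup>2)"
          using F fourier_diff[OF op_inv(1)[OF f] g] gx by (intro sum.cong) (auto simp: X_def)
        also have "\<dots> = (\<Sum>i\<in>F \<inter> H. (cmod (X (r n) i - x i))\<^sup>2) + (\<Sum>i\<in>F - H. (cmod (X (r n) i - x i))\<^sup>2)"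
          using F by (subst sum.Int_Diff[of F _ H]) auto
        also have "(\<Sum>i\<in>F \<inter> H. (cmod (X (r n) i - x i))\<^sup>2) \<le> (\<Sum>i\<in>H. (cmod (X (r n) i - x i))\<^sup>2)"
          using H by (intro sum_mono2) auto
        also have "(\<Sum>i\<in>F - H. (cmod (X (r n) i - x i))\<^sup>2) \<le> (b + b)\<^sup>2 / k"
          by (rule weighted_le_sum[OF weighted_le_diff[OF X xw b0 b0] _ _ k]) (use F in \<open>auto simp: H_def\<close>)
        finally show "(\<Sum>i\<in>F. (cmod (fourier M v (\<lambda>y. op_inv (f (r n)) y - g y) i))\<^sup>2) \<le> e\<^sup>2"
          using n kb by simp
      qed (use e in simp)
      then show "dist (L2_norm M (\<lambda>y. op_inv (f (r n)) y - g y)) 0 < e'"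
        using e(2) by (simp add: dist_real_def)
    qed
  qed
  then show "\<exists>r g. strict_mono r \<and> g \<in> L2 M \<and>
      (\<lambda>n. L2_norm M (\<lambda>x. op_inv (f (r n)) x - g x)) \<longlonglongrightarrow> 0"
    using r g by blast
qed

end

section \<open>Invertibility under diagonal dominance\<close>

lemma finite_index_norm_less: "finite {\<xi> :: int^'l::finite. index_norm \<xi> < N}"
proof -
  have "{\<xi> :: int^'l. index_norm \<xi> < N} \<subseteq> (\<lambda>f. \<chi> i. f i) ` (UNIV \<rightarrow>\<^sub>E {-\<lceil>N\<rceil>..\<lceil>N\<rceil>})"
  proof
    fix \<xi> :: "int^'l" assume "\<xi> \<in> {\<xi>. index_norm \<xi> < N}"
    then have "\<bar>real_of_int (\<xi> $ i)\<bar> \<le> N" for i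
      using component_le_norm_cart[of "\<chi> i. real_of_int (\<xi> $ i)" i] by (simp add: index_norm_def)
    then have "- \<lceil>N\<rceil> \<le> \<xi> $ i \<and> \<xi> $ i \<le> \<lceil>N\<rceil>" for i
      by (smt (verit) le_of_int_ceiling of_int_le_iff of_int_minus)
    then have "($) \<xi> \<in> UNIV \<rightarrow>\<^sub>E {-\<lceil>N\<rceil>..\<lceil>N\<rceil>}"
      by auto
    then show "\<xi> \<in> (\<lambda>f. \<chi> i. f i) ` (UNIV \<rightarrow>\<^sub>E {-\<lceil>N\<rceil>..\<lceil>N\<rceil>})"
      by (intro image_eqI[of _ _ "($) \<xi>"]) (simp_all add: vec_nth_inverse)
  qed
  then show ?thesis
    by (rule finite_subset) (intro finite_imageI finite_PiE finite_atLeastAtMost_int finite)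
qed

lemma finite_sum_le_of_ennreal_infsum:
  assumes d: "0 < d" and q: "0 \<le> q"
    and le: "inverse (ennreal d) * (\<Sum>\<^sub>\<infinity>j\<in>J. ennreal (a j)) \<le> ennreal q"
    and F: "finite F" "F \<subseteq> J" and a: "\<And>j. 0 \<le> a j"
  shows "sum a F \<le> q * d"
proof -
  have "ennreal (sum a F) = (\<Sum>j\<in>F. ennreal (a j))"
    using a by (simp add: sum_ennreal)
  also have "\<dots> \<le> (\<Sum>\<^sub>\<infinity>j\<in>J. ennreal (a j))"
    by (subst nonneg_infsum_complete) (use F in \<open>auto intro!: SUP_upper\<close>)
  also have "\<dots> = ennreal d * (inverse (ennreal d) * (\<Sum>\<^sub>\<infinity>j\<in>J. ennreal (a j)))"
    using d by (simp add: inverse_ennreal mult.assoc[symmetric] flip: ennreal_mult)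
  also have "\<dots> \<le> ennreal d * ennreal q"
    by (intro mult_left_mono le) simp
  also have "\<dots> = ennreal (q * d)"
    using d q by (simp add: mult.commute flip: ennreal_mult)
  finally show ?thesis
    using d q by simp
qed

text \<open>Biorthogonality leaves one term of the series; hence the diagonal entries of the matrix are the
  integrals in the hypotheses.\<close>

lemma psdo_eigenfunction:
  assumes "\<xi> \<in> I" "\<And>\<eta>. \<eta> \<in> I \<Longrightarrow> L2_inner M (u \<xi>) (v \<eta>) = (if \<xi> = \<eta> then 1 else 0)"
  shows "psdo M I u v \<sigma> (u \<xi>) x = \<sigma> x \<xi> * u \<xi> x"
proof -
  have "psdo M I u v \<sigma> (u \<xi>) x = (\<Sum>\<^sub>\<infinity>\<eta>\<in>{\<xi>}. \<sigma> x \<eta> * fourier M v (u \<xi>) \<eta> * u \<eta> x)"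
    unfolding psdo_def
    by (rule infsum_cong_neutral) (use assms in \<open>auto simp: fourier_def L2_inner_def\<close>)
  also have "\<dots> = \<sigma> x \<xi> * u \<xi> x"
    using assms by (simp add: fourier_def L2_inner_def)
  finally show ?thesis .
qed

theorem theorem5p11:
  fixes \<Omega> :: "'a::t2_space set"
    and A :: "('a, 'd::finite) chart set"
    and M :: "'a measure"
    and m :: nat
    and L :: "('a \<Rightarrow> complex) \<Rightarrow> 'a \<Rightarrow> complex"
    and BC :: "('a \<Rightarrow> complex) set"
    and I :: "(int^'l::finite) set"
    and lam :: "int^'l \<Rightarrow> complex"
    and u v :: "int^'l \<Rightarrow> 'a \<Rightarrow> complex"
    and \<sigma> :: "'a \<Rightarrow> int^'l \<Rightarrow> complex"
  assumes setting: "nonharmonic_setting \<Omega> A M m L BC I lam u v"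
    and symbol: "\<sigma> \<in> symbol_class \<Omega> M I"
    and cond_i: "0 < (INF \<xi>\<in>I. ennreal (cmod (LINT x|M. \<sigma> x \<xi> * u \<xi> x * cnj (v \<xi> x))))"
    and cond_ii: "(SUP \<xi>\<in>I.
        inverse (ennreal (cmod (LINT x|M. \<sigma> x \<xi> * u \<xi> x * cnj (v \<xi> x)))) *
        (\<Sum>\<^sub>\<infinity>\<zeta>\<in>I - {\<xi>}. ennreal (cmod (L2_inner M (psdo M I u v \<sigma> (u \<zeta>)) (v \<xi>))))) < 1"
    and cond_iii: "(SUP \<xi>\<in>I.
        inverse (ennreal (cmod (LINT x|M. \<sigma> x \<xi> * u \<xi> x * cnj (v \<xi> x)))) *
        (\<Sum>\<^sub>\<infinity>\<zeta>\<in>I - {\<xi>}. ennreal (cmod (L2_inner M (psdo M I u v \<sigma> (u \<xi>)) (v \<zeta>))))) < 1"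
  shows "L2_linear_op M (psdo_domain M I u v \<sigma>) (psdo_L2 M I u v \<sigma>) \<and>
    (\<exists>S. L2_inverse_op M (psdo_domain M I u v \<sigma>) (psdo_L2 M I u v \<sigma>) S \<and>
       L2_bounded_op M S \<and>
       (filterlim (\<lambda>\<xi>. cmod (LINT x|M. \<sigma> x \<xi> * u \<xi> x * cnj (v \<xi> x))) at_top
          (inf (filtercomap index_norm at_top) (principal I)) \<longrightarrow>
        L2_compact_op M S))"
proof -
  interpret nonharmonic_setting \<Omega> A M m L BC I lam u v by (rule setting)
  let ?B = "psdo_matrix M I u v \<sigma>"
  let ?d = "\<lambda>\<xi>. LINT x|M. \<sigma> x \<xi> * u \<xi> x * cnj (v \<xi> x)"
  have diag: "?d \<xi> = ?B \<xi> \<xi>" if "\<xi> \<in> I" for \<xi>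
    using psdo_eigenfunction[of \<xi> I M u v \<sigma>] biorthogonal that
    by (simp add: psdo_matrix_def L2_inner_def)

  obtain \<delta> where \<delta>: "0 < \<delta>" "ennreal \<delta> < (INF \<xi>\<in>I. ennreal (cmod (?d \<xi>)))"
  proof -
    obtain z where z: "0 < z" "z < (INF \<xi>\<in>I. ennreal (cmod (?d \<xi>)))"
      using Orderings.dense[OF cond_i] by blast
    then have "ennreal (enn2real z) = z"
      by (intro ennreal_enn2real) (meson less_le_trans top_greatest)
    then show ?thesis
      using that[of "enn2real z"] z by (metis enn2real_nonneg ennreal_0 less_le)
  qed
  have diag_ge: "\<delta> \<le> cmod (?B \<xi> \<xi>)" if "\<xi> \<in> I" for \<xi>
  proof -
    have "ennreal \<delta> \<le> ennreal (cmod (?d \<xi>))"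
      by (rule order_trans[OF less_imp_le[OF \<delta>(2)] INF_lower[OF that]])
    then show ?thesis using diag[OF that] by (subst (asm) ennreal_le_iff) simp_all
  qed

  \<comment> \<open>a common constant for the row and the column condition\<close>
  define s where "s = max
     (SUP \<xi>\<in>I. inverse (ennreal (cmod (?d \<xi>))) * (\<Sum>\<^sub>\<infinity>\<zeta>\<in>I - {\<xi>}. ennreal (cmod (?B \<xi> \<zeta>))))
     (SUP \<xi>\<in>I. inverse (ennreal (cmod (?d \<xi>))) * (\<Sum>\<^sub>\<infinity>\<zeta>\<in>I - {\<xi>}. ennreal (cmod (?B \<zeta> \<xi>))))"
  have s: "s < 1"
    using cond_ii cond_iii by (simp add: s_def psdo_matrix_def)
  define q where "q = enn2real s"
  have sq: "s = ennreal q" "0 \<le> q"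
    using less_le_trans[OF s top_greatest] by (simp_all add: q_def)
  then have q: "q < 1"
    using s by (simp add: ennreal_less_iff flip: ennreal_1)
  have row: "inverse (ennreal (cmod (?B \<xi> \<xi>))) * (\<Sum>\<^sub>\<infinity>\<zeta>\<in>I - {\<xi>}. ennreal (cmod (?B \<xi> \<zeta>))) \<le> ennreal q"
    and col: "inverse (ennreal (cmod (?B \<xi> \<xi>))) * (\<Sum>\<^sub>\<infinity>\<zeta>\<in>I - {\<xi>}. ennreal (cmod (?B \<zeta> \<xi>))) \<le> ennreal q"
    if "\<xi> \<in> I" for \<xi>
    unfolding sq(1)[symmetric] s_def diag[OF that, symmetric]
    by (rule max.coboundedI1[OF SUP_upper[OF that]], rule max.coboundedI2[OF SUP_upper[OF that]])

  obtain c C where cC: "0 < c" "c \<le> C" and frame: "\<forall>F a. finite F \<and> F \<subseteq> I \<longrightarrow>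
        c * (\<Sum>\<xi>\<in>F. (cmod (a \<xi>))\<^sup>2) \<le> (L2_norm M (\<lambda>x. \<Sum>\<xi>\<in>F. a \<xi> * u \<xi> x))\<^sup>2 \<and>
        (L2_norm M (\<lambda>x. \<Sum>\<xi>\<in>F. a \<xi> * u \<xi> x))\<^sup>2 \<le> C * (\<Sum>\<xi>\<in>F. (cmod (a \<xi>))\<^sup>2)"
    using u_riesz[unfolded riesz_basis_def, THEN conjunct2, THEN conjunct2]
    by (elim exE conjE) (rule that)
  interpret T: dominant_operator M I u v c C ?B \<delta> q
  proof
    show "u \<xi> \<in> L2 M" if "\<xi> \<in> I" for \<xi>
      using u_riesz that by (simp add: riesz_basis_def)
    show "v \<xi> \<in> L2 M" if "\<xi> \<in> I" for \<xi>
      using v_eigen[OF that] by (simp add: L2_adjoint_def)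
    show "\<exists>F a. finite F \<and> F \<subseteq> I \<and> L2_norm M (\<lambda>x. f x - (\<Sum>i\<in>F. a i * u i x)) < e"
      if "f \<in> L2 M" "0 < e" for f e
      using u_riesz[unfolded riesz_basis_def, THEN conjunct2, THEN conjunct1] that by simp
    show "(\<Sum>j\<in>F. cmod (?B i j)) \<le> q * cmod (?B i i)" if "i \<in> I" "finite F" "F \<subseteq> I - {i}" for i F
      using diag_ge[OF that(1)] \<delta>(1) sq(2) row[OF that(1)] that(2,3)
      by (intro finite_sum_le_of_ennreal_infsum) auto
    show "(\<Sum>i\<in>F. cmod (?B i j)) \<le> q * cmod (?B j j)" if "j \<in> I" "finite F" "F \<subseteq> I - {j}" for j F
      using diag_ge[OF that(1)] \<delta>(1) sq(2) col[OF that(1)] that(2,3)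
      by (intro finite_sum_le_of_ennreal_infsum) auto
  qed (use v_norm biorthogonal cC frame \<delta>(1) sq(2) q diag_ge in simp_all)
  have T: "psdo_domain M I u v \<sigma> = T.dom" "psdo_L2 M I u v \<sigma> = T.op"
    by (auto simp: psdo_domain_def T.dom_def psdo_L2_def T.op_def)
  have "L2_compact_op M T.op_inv"
    if lim: "filterlim (\<lambda>\<xi>. cmod (?d \<xi>)) at_top (inf (filtercomap index_norm at_top) (principal I))"
  proof (rule T.op_inv_compact)
    show "countable I" by simp
    fix k :: real
    have "\<forall>\<^sub>F \<xi> in inf (filtercomap index_norm at_top) (principal I). k \<le> cmod (?d \<xi>)"
      using lim by (simp add: filterlim_at_top)
    then obtain N where N: "\<And>\<xi>. N \<le> index_norm \<xi> \<Longrightarrow> \<xi> \<in> I \<Longrightarrow> k \<le> cmod (?d \<xi>)"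
      by (auto simp: eventually_inf_principal eventually_filtercomap_at_top_linorder)
    have "{\<xi> \<in> I. cmod (?B \<xi> \<xi>) < k} \<subseteq> {\<xi>. index_norm \<xi> < N}"
      using N diag by force
    then show "finite {\<xi> \<in> I. cmod (?B \<xi> \<xi>) < k}"
      using finite_index_norm_less by (rule finite_subset)
  qed
  then show ?thesis
    using T.op_linear T.op_inverse T.op_inv_bounded unfolding T by blast
qed

end
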